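(* Let $X$ be a semi-rectifiable compact plane set, let $\mathcal{F}$ be an effective collection of paths in $X$, and let $M=(M_n)_{n=0}^\infty$ be an algebra sequence which satisfies $\sum_{n=1}^\infty M_n^{-1/n}=+\infty$. Then $D_{\mathcal{F}}(X,M)$ is $\mathcal{F}$-quasianalytic.
   Context: A compact plane set is a non-empty compact subset of $\mathbb{C}$. A path in $\mathbb{C}$ is a continuous function $\gamma:[a,b]\to\mathbb{C}$ with $a<b$ real; its endpoints are $\gamma^-=\gamma(a)$, $\gamma^+=\gamma(b)$, its image is $\gamma^*=\gamma([a,b])$, and it is a path in $X$ if $\gamma^*\subseteq X$. A subpath of $\gamma$ is a restriction of $\gamma$ to a non-degenerate closed subinterval of $[a,b]$. A path is rectifiable if it has finite length, and admissible if it is rectifiable and has no constant subpaths. A Jordan path is an injective path. A collection $\mathcal{F}$ of paths in a perfect compact plane set $X$ is effective if $\bigcup_{\gamma\in\mathcal{F}}\gamma^*$ is dense in $X$, each path in $\mathcal{F}$ is admissible, and each subpath of a path in $\mathcal{F}$ belongs to $\mathcal{F}$. $X$ is semi-rectifiable if the set of all Jordan paths in $X$ is an effective collection of paths in $X$ (such $X$ is perfect). For $f\in C(X)$ (continuous complex-valued functions on $X$), a function $g\in C(X)$ is an $\mathcal{F}$-derivative of $f$ if $\int_\gamma g(z)\,dz=f(\gamma^+)-f(\gamma^-)$ for every $\gamma\in\mathcal{F}$; when $\mathcal{F}$ is effective such a $g$ is unique when it exists and is denoted $f^{[1]}$. Let $D_{\mathcal{F}}^{(1)}(X)$ be the set of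 all $f\in C(X)$ having an $\mathcal{F}$-derivative, and inductively $D_{\mathcal{F}}^{(n)}(X)=\{f\in D_{\mathcal{F}}^{(1)}(X): f^{[1]}\in D_{\mathcal{F}}^{(n-1)}(X)\}$ for $n\ge 2$; $f^{[n]}$ denotes the $n$th $\mathcal{F}$-derivative, $f^{[0]}=f$, and $D_{\mathcal{F}}^{(\infty)}(X)=\bigcap_{n\geq 1}D_{\mathcal{F}}^{(n)}(X)$. A sequence $M=(M_n)_{n=0}^\infty$ of positive real numbers is an algebra sequence if $M_0=1$ and $\binom{j+k}{k}\leq \frac{M_{j+k}}{M_jM_k}$ for all integers $j,k\geq 0$. With $|h|_X=\sup_{x\in X}|h(x)|$, define the algebra (with pointwise operations) $$D_{\mathcal{F}}(X,M)=\Bigl\{f\in D_{\mathcal{F}}^{(\infty)}(X):\sum_{j=0}^\infty \frac{|f^{[j]}|_X}{M_j}<\infty\Bigr\}.$$ A subalgebra $A$ of $D_{\mathcal{F}}^{(\infty)}(X)$ is $\mathcal{F}$-quasianalytic if, for each $\gamma\in\mathcal{F}$ and $z_0\in\gamma^*$, the conditions $f\in A$ and $f^{[k]}(z_0)=0$ for all $k=0,1,2,\dots$ together imply that $f(z)=0$ for all $z\in\gamma^*$. *)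

theory Defs
  imports "HOL-Analysis.Analysis"
begin

(* The triple (a, b, g) is the path g : [a,b] -> C.  Maps out of [a,b], and likewise functions on
   a compact set X, are represented by extensional functions, so that equality of representatives
   is equality of maps and restriction is restrict. *)
type_synonym plane_path = "real \<times> real \<times> (real \<Rightarrow> complex)"

definition plane_paths :: "plane_path set" where
  "plane_paths = {(a, b, g). a < b \<and> continuous_on {a..b} g \<and> g \<in> extensional {a..b}}"

fun start_point :: "plane_path \<Rightarrow> complex" where
  "start_point (a, b, g) = g a"

fun end_point :: "plane_path \<Rightarrow> complex" where
  "end_point (a, b, g) = g b"

fun path_trace :: "plane_path \<Rightarrow> complex set" where
  "path_trace (a, b, g) = g ` {a..b}"

definition paths_in :: "complex set \<Rightarrow> plane_path set" where
  "paths_in X = {\<gamma> \<in> plane_paths. path_trace \<gamma> \<subseteq> X}"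

fun subpaths :: "plane_path \<Rightarrow> plane_path set" where
  "subpaths (a, b, g) = {(c, d, restrict g {c..d}) | c d. a \<le> c \<and> c < d \<and> d \<le> b}"

fun constant_path :: "plane_path \<Rightarrow> bool" where
  "constant_path (a, b, g) \<longleftrightarrow> g constant_on {a..b}"

fun jordan_path :: "plane_path \<Rightarrow> bool" where
  "jordan_path (a, b, g) \<longleftrightarrow> inj_on g {a..b}"

(* The length is the supremum of the lengths of the inscribed polygons. *)
fun rectifiable :: "plane_path \<Rightarrow> bool" where
  "rectifiable (a, b, g) \<longleftrightarrow>
     bdd_above {(\<Sum>K\<in>d. norm (g (Sup K) - g (Inf K))) | d. d division_of {a..b}}"

definition admissible :: "plane_path \<Rightarrow> bool" where
  "admissible \<gamma> \<longleftrightarrow> rectifiable \<gamma> \<and> (\<forall>\<delta>\<in>subpaths \<gamma>. \<not> constant_path \<delta>)"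

(* Riemann-Stieltjes integral of h(z) dz along a path, as the limit of Riemann sums when the mesh
   tends to 0.  The library's contour integral does not serve here: it integrates against the
   pointwise derivative of the path, which loses the singular part of a path that is merely
   rectifiable. *)
fun has_path_integral :: "(complex \<Rightarrow> complex) \<Rightarrow> complex \<Rightarrow> plane_path \<Rightarrow> bool" where
  "has_path_integral h I (a, b, g) \<longleftrightarrow>
     (\<forall>e>0. \<exists>r>0. \<forall>p. p tagged_division_of {a..b} \<and> (\<lambda>t. ball t r) fine p \<longrightarrow>
        norm ((\<Sum>(t, K)\<in>p. h (g t) * (g (Sup K) - g (Inf K))) - I) < e)"

definition effective :: "complex set \<Rightarrow> plane_path set \<Rightarrow> bool" where
  "effective X F \<longleftrightarrow>
     compact X \<and> X \<noteq> {} \<and> (\<forall>x\<in>X. x islimpt X) \<and> F \<subseteq> paths_in X \<and>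
     X \<subseteq> closure (\<Union>\<gamma>\<in>F. path_trace \<gamma>) \<and>
     (\<forall>\<gamma>\<in>F. admissible \<gamma>) \<and>
     (\<forall>\<gamma>\<in>F. subpaths \<gamma> \<subseteq> F)"

definition semi_rectifiable :: "complex set \<Rightarrow> bool" where
  "semi_rectifiable X \<longleftrightarrow> effective X {\<gamma> \<in> paths_in X. jordan_path \<gamma>}"

definition cont_funs :: "complex set \<Rightarrow> (complex \<Rightarrow> complex) set" where
  "cont_funs X = {f. continuous_on X f \<and> f \<in> extensional X}"

definition has_F_deriv ::
    "complex set \<Rightarrow> plane_path set \<Rightarrow> (complex \<Rightarrow> complex) \<Rightarrow> (complex \<Rightarrow> complex) \<Rightarrow> bool" where
  "has_F_deriv X F f f' \<longleftrightarrow>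
     f' \<in> cont_funs X \<and>
     (\<forall>\<gamma>\<in>F. has_path_integral f' (f (end_point \<gamma>) - f (start_point \<gamma>)) \<gamma>)"

(* Meaningful when F is effective and f has an F-derivative, which is then unique. *)
definition F_deriv ::
    "complex set \<Rightarrow> plane_path set \<Rightarrow> (complex \<Rightarrow> complex) \<Rightarrow> complex \<Rightarrow> complex" where
  "F_deriv X F f = (THE f'. has_F_deriv X F f f')"

definition F_deriv_n ::
    "complex set \<Rightarrow> plane_path set \<Rightarrow> nat \<Rightarrow> (complex \<Rightarrow> complex) \<Rightarrow> complex \<Rightarrow> complex" where
  "F_deriv_n X F n f = (F_deriv X F ^^ n) f"

(* The value at 0 is a convention; only n >= 1 is used. *)
fun D_F :: "complex set \<Rightarrow> plane_path set \<Rightarrow> nat \<Rightarrow> (complex \<Rightarrow> complex) set" where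
  "D_F X F 0 = cont_funs X"
| "D_F X F (Suc 0) = {f \<in> cont_funs X. \<exists>f'. has_F_deriv X F f f'}"
| "D_F X F (Suc (Suc n)) = {f \<in> D_F X F (Suc 0). F_deriv X F f \<in> D_F X F (Suc n)}"

definition D_F_inf :: "complex set \<Rightarrow> plane_path set \<Rightarrow> (complex \<Rightarrow> complex) set" where
  "D_F_inf X F = (\<Inter>n\<in>{1..}. D_F X F n)"

definition algebra_sequence :: "(nat \<Rightarrow> real) \<Rightarrow> bool" where
  "algebra_sequence M \<longleftrightarrow>
     (\<forall>n. M n > 0) \<and> M 0 = 1 \<and>
     (\<forall>j k. real ((j + k) choose k) \<le> M (j + k) / (M j * M k))"

definition sup_norm_on :: "complex set \<Rightarrow> (complex \<Rightarrow> complex) \<Rightarrow> real" where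
  "sup_norm_on X h = (SUP x\<in>X. norm (h x))"

definition D_F_alg ::
    "complex set \<Rightarrow> plane_path set \<Rightarrow> (nat \<Rightarrow> real) \<Rightarrow> (complex \<Rightarrow> complex) set" where
  "D_F_alg X F M =
     {f \<in> D_F_inf X F. summable (\<lambda>j. sup_norm_on X (F_deriv_n X F j f) / M j)}"

definition subalgebra_on ::
    "complex set \<Rightarrow> (complex \<Rightarrow> complex) set \<Rightarrow> (complex \<Rightarrow> complex) set \<Rightarrow> bool" where
  "subalgebra_on X A B \<longleftrightarrow>
     A \<subseteq> B \<and> (\<lambda>z\<in>X. 0) \<in> A \<and>
     (\<forall>f\<in>A. \<forall>g\<in>A. (\<lambda>z\<in>X. f z + g z) \<in> A) \<and>
     (\<forall>c. \<forall>f\<in>A. (\<lambda>z\<in>X. c * f z) \<in> A) \<and>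
     (\<forall>f\<in>A. \<forall>g\<in>A. (\<lambda>z\<in>X. f z * g z) \<in> A)"

definition F_quasianalytic ::
    "complex set \<Rightarrow> plane_path set \<Rightarrow> (complex \<Rightarrow> complex) set \<Rightarrow> bool" where
  "F_quasianalytic X F A \<longleftrightarrow>
     subalgebra_on X A (D_F_inf X F) \<and>
     (\<forall>\<gamma>\<in>F. \<forall>z0\<in>path_trace \<gamma>. \<forall>f\<in>A.
        (\<forall>k. F_deriv_n X F k f z0 = 0) \<longrightarrow> (\<forall>z\<in>path_trace \<gamma>. f z = 0))"

end

theory Submission
  imports Defs
begin

text \<open>
  Let \<open>l\<close> be the arc length along a path of \<open>F\<close>. Along the path, the increment of
  \<open>f\<^sup>[\<^sup>n\<^sup>]\<close> is bounded by the supremum of \<open>f\<^sup>[\<^sup>n\<^sup>+\<^sup>1\<^sup>]\<close> times the increment of \<open>l\<close>; this is all the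
  smoothness there is, and it suffices for Bang's proof of the Denjoy--Carleman theorem.
  If \<open>\<bar>f\<^sup>[\<^sup>n\<^sup>]\<bar> \<le> A c\<^sup>n\<close> at a point for all \<open>n \<le> q\<close>, and everywhere for \<open>n = q\<close>, then descending induction on
  \<open>n\<close> gives \<open>\<bar>f\<^sup>[\<^sup>n\<^sup>]\<bar> \<le> A c\<^sup>n exp (c h)\<close> at arc length distance \<open>h\<close>. One runs through orders \<open>q\<close> and rates
  \<open>c\<close> descending from arbitrarily high ones, with \<open>A\<close> proportional to \<open>exp (- q)\<close>. No logarithmically
  convex minorant of \<open>M\<close> is used: with \<open>N\<^sub>j\<close> the largest \<open>n\<close> such that \<open>M\<^sub>n \<le> 4\<^bsup>jn\<^esup>\<close>, divergence of
  \<open>\<Sum> M\<^sub>n\<^bsup>-1/n\<^esup>\<close> forces that of \<open>\<Sum> N\<^sub>j 4\<^bsup>-j\<^esup>\<close>, even over those \<open>j\<close> at which \<open>N\<^sub>j 3\<^bsup>-j\<^esup>\<close> is a running maximum,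
  and between consecutive such \<open>j\<close> a distance comparable to \<open>N\<^sub>j 4\<^bsup>-j\<^esup>\<close> can be covered.

  That the algebra is closed under products rests on the uniqueness of derivatives: if \<open>h\<close> has
  vanishing integrals but \<open>h \<noteq> 0\<close> near some point, then the chords of the path are there at most
  half as long as the arcs, which contradicts the definition of length.
\<close>

subsection \<open>Arc length\<close>

text \<open>Speaking of a function \<open>l\<close> that dominates the variation of
  \<open>g\<close>, instead of suprema over polygons, makes it possible to cut, glue and modify
  candidates for the arc length.\<close>

definition variation_bound :: "(real \<Rightarrow> 'a::real_normed_vector) \<Rightarrow> real \<Rightarrow> real \<Rightarrow> (real \<Rightarrow> real) \<Rightarrow> bool" where
  "variation_bound g a b l \<longleftrightarrow>
     (\<forall>x y. a \<le> x \<longrightarrow> x \<le> y \<longrightarrow> y \<le> b \<longrightarrow> norm (g y - g x) \<le> l y - l x)"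

lemma variation_boundD:
  "variation_bound g a b l \<Longrightarrow> a \<le> x \<Longrightarrow> x \<le> y \<Longrightarrow> y \<le> b \<Longrightarrow> norm (g y - g x) \<le> l y - l x"
  by (auto simp: variation_bound_def)

lemma variation_bound_mono:
  assumes "variation_bound g a b l" "a \<le> x" "x \<le> y" "y \<le> b"
  shows "l x \<le> l y"
  using variation_boundD[OF assms] norm_ge_zero[of "g y - g x"] by linarith

lemma division_of_interval_elem:
  fixes c d :: real
  assumes "p division_of {c..d}" "K \<in> p"
  shows "K = {Inf K..Sup K}" "c \<le> Inf K" "Inf K \<le> Sup K" "Sup K \<le> d"
proof -
  obtain u v where K: "K = cbox u v" and sub: "K \<subseteq> {c..d}" and ne: "K \<noteq> {}"
    using division_ofD(2-4)[OF assms] by metis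
  then have "u \<le> v" by auto
  with K have *: "Inf K = u" "Sup K = v" by auto
  show "K = {Inf K..Sup K}" "c \<le> Inf K" "Inf K \<le> Sup K" "Sup K \<le> d"
    using K sub \<open>u \<le> v\<close> unfolding * by auto
qed

lemma additive_division_1:
  fixes f :: "real \<Rightarrow> 'a::real_normed_vector"
  assumes "a \<le> b" "d division_of {a..b}"
  shows "(\<Sum>K\<in>d. f (Sup K) - f (Inf K)) = f b - f a"
proof -
  \<comment> \<open>Each interval is tagged with its left end, so that the telescoping sum for
    tagged divisions applies.\<close>
  let ?p = "(\<lambda>K. (Inf K, K)) ` d"
  have "?p tagged_division_of {a..b}"
  proof (rule tagged_division_ofI)
    show "finite ?p" using assms(2) by auto
    show "x \<in> K" if "(x, K) \<in> ?p" for x K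
      using that division_of_interval_elem[OF assms(2)] by (metis (no_types, lifting) atLeastAtMost_iff imageE order_refl prod.inject)
    show "K \<subseteq> {a..b}" "\<exists>u v. K = cbox u v" if "(x, K) \<in> ?p" for x K
      using that division_ofD(2,4)[OF assms(2)] by (auto simp del: interval_cbox)
    show "interior K1 \<inter> interior K2 = {}"
      if "(x1, K1) \<in> ?p" "(x2, K2) \<in> ?p" "(x1, K1) \<noteq> (x2, K2)" for x1 K1 x2 K2
      using that assms(2) by (auto dest: division_ofD)
    show "\<Union> {K. \<exists>x. (x, K) \<in> ?p} = {a..b}"
      using assms(2) by (auto simp: image_iff dest!: division_ofD(6))
  qed
  from additive_tagged_division_1[OF assms(1) this, of f] show ?thesis
    by (subst (asm) sum.reindex) (auto simp: inj_on_def)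
qed

text \<open>Minimality says that \<open>l\<close> cannot lose any of its growth: it yields both the continuity of
  \<open>l\<close>, by removing a jump, and later the uniqueness of derivatives.\<close>

definition arc_length_on :: "(real \<Rightarrow> 'a::real_normed_vector) \<Rightarrow> real \<Rightarrow> real \<Rightarrow> (real \<Rightarrow> real) \<Rightarrow> bool" where
  "arc_length_on g a b l \<longleftrightarrow>
     variation_bound g a b l \<and> (\<forall>m. variation_bound g a b m \<longrightarrow> l b - l a \<le> m b - m a)"

text \<open>The witness \<open>l t\<close> is the supremum of the lengths of polygons inscribed in
  the arc over \<open>{a..t}\<close>. It is minimal because each polygon is bounded, chord by chord,
  by a telescoping sum of increments of a competitor \<open>m\<close>.\<close>

lemma arc_length_exists:
  fixes g :: "real \<Rightarrow> 'a::real_normed_vector"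
  assumes "a \<le> b"
    and bdd: "bdd_above {(\<Sum>K\<in>d. norm (g (Sup K) - g (Inf K))) | d. d division_of {a..b}}"
  obtains l where "arc_length_on g a b l"
proof
  define len where "len d = (\<Sum>K\<in>d. norm (g (Sup K) - g (Inf K)))" for d :: "real set set"
  define S where "S t = {len d | d. d division_of {a..t}}" for t
  define l where "l t = Sup (S t)" for t
  have S_ne: "norm (g t - g a) \<in> S t" if "a \<le> t" for t
  proof -
    have "{{a..t}} division_of {a..t}" using division_of_self[of a t] that by auto
    moreover have "len {{a..t}} = norm (g t - g a)" using that by (simp add: len_def)
    ultimately show ?thesis unfolding S_def by (metis (mono_tags, lifting) mem_Collect_eq)
  qed
  \<comment> \<open>One chord is appended to a polygon. With \<open>y = b\<close> this bounds every
    \<open>S t\<close> by the bound for \<open>S b\<close>; in general it yields the variation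
    bound.\<close>
  have ext: "v + norm (g y - g x) \<in> S y" if v: "v \<in> S x" and xy: "a \<le> x" "x \<le> y" for v x y
  proof (cases "x = y")
    case False
    with xy have "x < y" by simp
    obtain d where d: "d division_of {a..x}" "v = len d" using v by (auto simp: S_def)
    have new: "{x..y} \<notin> d"
    proof
      assume "{x..y} \<in> d"
      then have "{x..y} \<subseteq> {a..x}" using d(1) by blast
      with \<open>x < y\<close> show False by auto
    qed
    have "d \<union> {{x..y}} division_of {a..x} \<union> {x..y}"
    proof (rule division_disjoint_union[OF d(1)])
      show "{{x..y}} division_of {x..y}" using division_of_self[of x y] \<open>x < y\<close> by auto
    qed auto
    moreover have "{a..x} \<union> {x..y} = {a..y}" using xy by auto
    moreover have "len (d \<union> {{x..y}}) = v + norm (g y - g x)"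
      using new d division_of_finite[OF d(1)] xy by (simp add: len_def)
    ultimately show ?thesis unfolding S_def by (metis (mono_tags, lifting) mem_Collect_eq)
  qed (use v in simp)
  obtain B where B: "\<And>v. v \<in> S b \<Longrightarrow> v \<le> B"
    using bdd unfolding S_def len_def bdd_above_def by blast
  have bddS: "bdd_above (S t)" if "a \<le> t" "t \<le> b" for t
  proof (rule bdd_aboveI)
    show "v \<le> B" if "v \<in> S t" for v
      using B[OF ext[OF that \<open>a \<le> t\<close> \<open>t \<le> b\<close>]] norm_ge_zero[of "g b - g t"] by linarith
  qed
  have vb: "variation_bound g a b l"
    unfolding variation_bound_def
  proof (intro allI impI)
    fix x y assume xy: "a \<le> x" "x \<le> y" "y \<le> b"
    have "l x \<le> l y - norm (g y - g x)"
      unfolding l_def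
    proof (rule cSup_least)
      show "S x \<noteq> {}" using S_ne[OF xy(1)] by auto
      fix v assume "v \<in> S x"
      from cSup_upper[OF ext[OF this xy(1,2)] bddS] xy
      show "v \<le> Sup (S y) - norm (g y - g x)" by simp
    qed
    then show "norm (g y - g x) \<le> l y - l x" by simp
  qed
  have "l b - l a \<le> m b - m a" if m: "variation_bound g a b m" for m
  proof -
    have "l b \<le> m b - m a"
      unfolding l_def
    proof (rule cSup_least)
      show "S b \<noteq> {}" using S_ne[OF \<open>a \<le> b\<close>] by auto
      fix v assume "v \<in> S b"
      then obtain d where d: "d division_of {a..b}" "v = len d" by (auto simp: S_def)
      have "v \<le> (\<Sum>K\<in>d. m (Sup K) - m (Inf K))"
        unfolding d(2) len_def
        by (intro sum_mono variation_boundD[OF m] division_of_interval_elem[OF d(1)])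
      also have "\<dots> = m b - m a" by (rule additive_division_1[OF \<open>a \<le> b\<close> d(1)])
      finally show "v \<le> m b - m a" .
    qed
    moreover have "0 \<le> l a"
      unfolding l_def using cSup_upper[OF S_ne[of a] bddS[of a]] \<open>a \<le> b\<close> by simp
    ultimately show ?thesis by simp
  qed
  with vb show "arc_length_on g a b l" by (auto simp: arc_length_on_def)
qed

text \<open>\<open>P\<close> marks what lies to the right of a cut. If all chords across the cut
  have \<open>e\<close> to spare, \<open>l\<close> can be lowered by \<open>e\<close> there, against
  minimality. A predicate in place of a cut point lets that point lie on either side.\<close>

lemma arc_length_on_no_loss:
  assumes arc: "arc_length_on g a b l" and "a \<le> b" and "0 < e"
    and P: "\<not> P a" "P b" "\<And>u v. u \<le> v \<Longrightarrow> P u \<Longrightarrow> P v"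
    and cross: "\<And>u v. a \<le> u \<Longrightarrow> u \<le> v \<Longrightarrow> v \<le> b \<Longrightarrow> \<not> P u \<Longrightarrow> P v \<Longrightarrow> norm (g v - g u) \<le> l v - e - l u"
  shows False
proof -
  define m where "m t = (if P t then l t - e else l t)" for t
  have "variation_bound g a b m"
    unfolding variation_bound_def
  proof (intro allI impI)
    fix x y assume xy: "a \<le> x" "x \<le> y" "y \<le> b"
    have "norm (g y - g x) \<le> l y - l x"
      using arc xy by (auto simp: arc_length_on_def variation_bound_def)
    with cross[OF xy] P(3)[OF xy(2)] show "norm (g y - g x) \<le> m y - m x"
      by (auto simp: m_def)
  qed
  with arc have "l b - l a \<le> m b - m a" by (auto simp: arc_length_on_def)
  with P \<open>0 < e\<close> show False by (auto simp: m_def)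
qed

text \<open>A monotone function is discontinuous only through jumps. At a jump of \<open>l\<close>
  of height \<open>e\<close>, continuity of \<open>g\<close> leaves every chord across it shorter
  than the growth of \<open>l\<close> by at least \<open>e\<close>, which
  \<open>arc_length_on_no_loss\<close> forbids.\<close>

lemma continuous_on_arc_length:
  assumes arc: "arc_length_on g a b l" and "a \<le> b" and g: "continuous_on {a..b} g"
  shows "continuous_on {a..b} l"
proof -
  have vb: "variation_bound g a b l" using arc by (simp add: arc_length_on_def)
  note D = variation_boundD[OF vb]
  note mono = variation_bound_mono[OF vb]
  have near: "\<exists>r>0. \<forall>w\<in>{a..b}. \<bar>w - x\<bar> < r \<longrightarrow> norm (g w - g x) < e" if "x \<in> {a..b}" "0 < e" for x e
    using g that unfolding continuous_on_iff dist_norm by (auto simp: real_norm_def)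
  have right: "\<exists>y. x < y \<and> y \<le> b \<and> l y < l x + e" if x: "a \<le> x" "x < b" and e: "0 < e" for x e
  proof (rule ccontr)
    assume "\<not> ?thesis"
    then have gap: "l x + e \<le> l y" if "x < y" "y \<le> b" for y using that by force
    show False
    proof (rule arc_length_on_no_loss[OF arc \<open>a \<le> b\<close> e, of "\<lambda>t. x < t"])
      fix u v assume uv: "a \<le> u" "u \<le> v" "v \<le> b" "\<not> x < u" "x < v"
      show "norm (g v - g u) \<le> l v - e - l u"
      proof (rule field_le_epsilon)
        fix h :: real assume "0 < h"
        obtain r where r: "r > 0" "\<And>w. w \<in> {a..b} \<Longrightarrow> \<bar>w - x\<bar> < r \<Longrightarrow> norm (g w - g x) < h"
          using near[of x h] x \<open>0 < h\<close> by auto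
        \<comment> \<open>The chord is split at \<open>x\<close> and at a point \<open>w\<close>
          just beyond the cut: from \<open>x\<close> to \<open>w\<close> the path moves by less than
          \<open>h\<close>, while \<open>l\<close> grows by at least \<open>e\<close>.\<close>
        define w where "w = min v (x + r / 2)"
        have w: "x < w" "w \<le> v" "\<bar>w - x\<bar> < r" using r(1) uv by (auto simp: w_def min_def)
        have "norm (g v - g u) = norm ((g v - g w) + (g w - g x) + (g x - g u))" by simp
        also have "\<dots> \<le> norm (g v - g w) + norm (g w - g x) + norm (g x - g u)"
          by (intro norm_triangle_mono norm_triangle_ineq) auto
        also have "\<dots> \<le> (l v - l w) + h + (l x - l u)"
          using w uv x r(2)[of w] by (intro add_mono D) auto
        finally show "norm (g v - g u) \<le> l v - e - l u + h"
          using gap[of w] w uv by linarith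
      qed
    qed (use x in auto)
  qed
  have left: "\<exists>y. a \<le> y \<and> y < x \<and> l x - e < l y" if x: "a < x" "x \<le> b" and e: "0 < e" for x e
  proof (rule ccontr)
    assume "\<not> ?thesis"
    then have gap: "l y \<le> l x - e" if "a \<le> y" "y < x" for y using that by force
    show False
    proof (rule arc_length_on_no_loss[OF arc \<open>a \<le> b\<close> e, of "\<lambda>t. x \<le> t"])
      fix u v assume uv: "a \<le> u" "u \<le> v" "v \<le> b" "\<not> x \<le> u" "x \<le> v"
      show "norm (g v - g u) \<le> l v - e - l u"
      proof (rule field_le_epsilon)
        fix h :: real assume "0 < h"
        obtain r where r: "r > 0" "\<And>w. w \<in> {a..b} \<Longrightarrow> \<bar>w - x\<bar> < r \<Longrightarrow> norm (g w - g x) < h"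
          using near[of x h] x \<open>0 < h\<close> by auto
        define w where "w = max u (x - r / 2)"
        have w: "w < x" "u \<le> w" "\<bar>w - x\<bar> < r" using r(1) uv by (auto simp: w_def max_def)
        have "norm (g v - g u) = norm ((g v - g x) + (g x - g w) + (g w - g u))" by simp
        also have "\<dots> \<le> norm (g v - g x) + norm (g x - g w) + norm (g w - g u)"
          by (intro norm_triangle_mono norm_triangle_ineq) auto
        also have "\<dots> \<le> (l v - l x) + h + (l w - l u)"
          using w uv x r(2)[of w] by (intro add_mono D) (auto simp: norm_minus_commute)
        finally show "norm (g v - g u) \<le> l v - e - l u + h"
          using gap[of w] w uv by linarith
      qed
    qed (use x in auto)
  qed
  show ?thesis
    unfolding continuous_on_iff
  proof (intro ballI allI impI)
    fix x e :: real assume x: "x \<in> {a..b}" and e: "0 < e"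
    obtain r1 where r1: "r1 > 0" "\<And>y. y \<in> {a..b} \<Longrightarrow> x \<le> y \<Longrightarrow> y < x + r1 \<Longrightarrow> l y < l x + e"
    proof (cases "x < b")
      case True
      then obtain y where y: "x < y" "y \<le> b" "l y < l x + e" using right[of x e] x e by auto
      show ?thesis
      proof (rule that[of "y - x"])
        fix t assume "t \<in> {a..b}" "x \<le> t" "t < x + (y - x)"
        then show "l t < l x + e" using mono[of t y] y by auto
      qed (use y in auto)
    next
      case False
      then show ?thesis using that[of 1] x e by auto
    qed
    obtain r2 where r2: "r2 > 0" "\<And>y. y \<in> {a..b} \<Longrightarrow> y \<le> x \<Longrightarrow> x - r2 < y \<Longrightarrow> l x - e < l y"
    proof (cases "a < x")
      case True
      then obtain y where y: "a \<le> y" "y < x" "l x - e < l y" using left[of x e] x e by auto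
      show ?thesis
      proof (rule that[of "x - y"])
        fix t assume "t \<in> {a..b}" "t \<le> x" "x - (x - y) < t"
        then show "l x - e < l t" using mono[of y t] y by auto
      qed (use y in auto)
    next
      case False
      then show ?thesis using that[of 1] x e by auto
    qed
    show "\<exists>d>0. \<forall>x'\<in>{a..b}. dist x' x < d \<longrightarrow> dist (l x') (l x) < e"
    proof (intro exI[of _ "min r1 r2"] conjI ballI impI)
      fix t assume t: "t \<in> {a..b}" "dist t x < min r1 r2"
      show "dist (l t) (l x) < e"
      proof (cases "x \<le> t")
        case True
        then show ?thesis using r1(2)[of t] mono[of x t] t x by (auto simp: dist_real_def)
      next
        case False
        then show ?thesis using r2(2)[of t] mono[of t x] t x by (auto simp: dist_real_def)
      qed
    qed (use r1 r2 in auto)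
  qed
qed

subsection \<open>Integration along rectifiable paths\<close>

lemma variation_bound_concat:
  assumes "variation_bound g a c l" "variation_bound g c b l"
  shows "variation_bound g a b l"
  unfolding variation_bound_def
proof (intro allI impI)
  fix x y assume xy: "a \<le> x" "x \<le> y" "y \<le> b"
  consider "y \<le> c" | "c \<le> x" | "x \<le> c" "c \<le> y" by linarith
  then show "norm (g y - g x) \<le> l y - l x"
  proof cases
    case 3
    have "norm (g y - g x) = norm ((g y - g c) + (g c - g x))" by simp
    also have "\<dots> \<le> (l y - l c) + (l c - l x)"
      using 3 xy by (intro norm_triangle_mono variation_boundD[OF assms(1)] variation_boundD[OF assms(2)]) auto
    finally show ?thesis by simp
  qed (use assms xy in \<open>auto simp: variation_bound_def\<close>)
qed

lemma variation_bound_subinterval: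
  "variation_bound g a b l \<Longrightarrow> a \<le> c \<Longrightarrow> d \<le> b \<Longrightarrow> variation_bound g c d l"
  by (auto simp: variation_bound_def)

lemma tagged_division_of_interval_elem:
  fixes c d :: real
  assumes "p tagged_division_of {c..d}" "(t, K) \<in> p"
  shows "K = {Inf K..Sup K}" "c \<le> Inf K" "Inf K \<le> t" "t \<le> Sup K" "Sup K \<le> d"
proof -
  obtain u v where K: "K = cbox u v" and sub: "K \<subseteq> {c..d}" and t: "t \<in> K"
    using tagged_division_ofD(2-4)[OF assms] by metis
  then have "u \<le> t" "t \<le> v" by auto
  with K have *: "Inf K = u" "Sup K = v" by auto
  show "K = {Inf K..Sup K}" "c \<le> Inf K" "Inf K \<le> t" "t \<le> Sup K" "Sup K \<le> d"
    using K sub \<open>u \<le> t\<close> \<open>t \<le> v\<close> unfolding * by auto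
qed

text \<open>Riemann sums of \<open>h - w\<close> are bounded by \<open>e\<close> times a telescoping
  sum of increments of \<open>l\<close>. The case \<open>w = 0\<close> estimates the integral
  itself, the case \<open>w = h (g t)\<close> its deviation from the linear approximation at
  \<open>t\<close>.\<close>

lemma has_path_integral_bound:
  assumes int: "has_path_integral h I (c, d, g)" and "c \<le> d" and vb: "variation_bound g c d l"
    and h: "\<And>s. s \<in> {c..d} \<Longrightarrow> norm (h (g s) - w) \<le> e"
  shows "norm (I - w * (g d - g c)) \<le> e * (l d - l c)"
proof (rule field_le_epsilon)
  fix \<eta> :: real assume "\<eta> > 0"
  then obtain r where r: "r > 0" "\<And>p. p tagged_division_of {c..d} \<Longrightarrow> (\<lambda>t. ball t r) fine p \<Longrightarrow>
        norm ((\<Sum>(t, K)\<in>p. h (g t) * (g (Sup K) - g (Inf K))) - I) < \<eta>"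
    using int by auto
  obtain p where p: "p tagged_division_of {c..d}" "(\<lambda>t. ball t r) fine p"
    using fine_division_exists_real[of "\<lambda>t. ball t r" c d] r(1) by (auto simp: gauge_def)
  define R where "R = (\<Sum>(t, K)\<in>p. h (g t) * (g (Sup K) - g (Inf K)))"
  have "w * (g d - g c) = (\<Sum>(t, K)\<in>p. w * (g (Sup K) - g (Inf K)))"
    unfolding additive_tagged_division_1[OF \<open>c \<le> d\<close> p(1), of g, symmetric]
    by (simp add: sum_distrib_left case_prod_unfold)
  then have "R - w * (g d - g c) = (\<Sum>(t, K)\<in>p. (h (g t) - w) * (g (Sup K) - g (Inf K)))"
    by (simp add: R_def case_prod_unfold sum_subtractf[symmetric] algebra_simps)
  also have "norm \<dots> \<le> (\<Sum>(t, K)\<in>p. e * (l (Sup K) - l (Inf K)))"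
    unfolding case_prod_unfold
  proof (rule sum_norm_le)
    fix q assume "q \<in> p"
    then have q: "(fst q, snd q) \<in> p" by simp
    note el = tagged_division_of_interval_elem[OF p(1) q]
    show "norm ((h (g (fst q)) - w) * (g (Sup (snd q)) - g (Inf (snd q)))) \<le> e * (l (Sup (snd q)) - l (Inf (snd q)))"
      unfolding norm_mult
    proof (rule mult_mono)
      show "norm (h (g (fst q)) - w) \<le> e" using el by (intro h) auto
      then show "0 \<le> e" using norm_ge_zero order_trans by blast
    qed (use el in \<open>auto intro!: variation_boundD[OF vb]\<close>)
  qed
  also have "\<dots> = e * (l d - l c)"
    unfolding additive_tagged_division_1[OF \<open>c \<le> d\<close> p(1), of l, symmetric]
    by (simp add: sum_distrib_left case_prod_unfold)
  finally have "norm (R - w * (g d - g c)) \<le> e * (l d - l c)" .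
  moreover have "norm (R - I) < \<eta>" using r(2)[OF p] by (simp add: R_def)
  moreover have "norm (I - w * (g d - g c)) \<le> norm (R - w * (g d - g c)) + norm (R - I)"
    using norm_triangle_ineq4[of "R - w * (g d - g c)" "R - I"] by (simp add: algebra_simps)
  ultimately show "norm (I - w * (g d - g c)) \<le> e * (l d - l c) + \<eta>" by linarith
qed

text \<open>A local form of \<open>\<phi> d - \<phi> c = (\<integral> h dg)\<close> over \<open>{c..d}\<close>, for \<open>\<phi>\<close> and \<open>h\<close> functions of the
  parameter; unlike the integral it is visibly compatible with products.\<close>

definition primitive_along ::
  "(real \<Rightarrow> complex) \<Rightarrow> (real \<Rightarrow> complex) \<Rightarrow> (real \<Rightarrow> complex) \<Rightarrow> real \<Rightarrow> real \<Rightarrow> (real \<Rightarrow> real) \<Rightarrow> bool" where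
  "primitive_along \<phi> h g a b l \<longleftrightarrow>
     (\<forall>e>0. \<exists>r>0. \<forall>c t d. a \<le> c \<longrightarrow> c \<le> t \<longrightarrow> t \<le> d \<longrightarrow> d \<le> b \<longrightarrow> d - c < r \<longrightarrow>
        norm (\<phi> d - \<phi> c - h t * (g d - g c)) \<le> e * (l d - l c))"

lemma primitive_alongD:
  assumes "primitive_along \<phi> h g a b l" "0 < e"
  obtains r where "r > 0" "\<And>c t d. a \<le> c \<Longrightarrow> c \<le> t \<Longrightarrow> t \<le> d \<Longrightarrow> d \<le> b \<Longrightarrow> d - c < r \<Longrightarrow>
        norm (\<phi> d - \<phi> c - h t * (g d - g c)) \<le> e * (l d - l c)"
  using assms unfolding primitive_along_def by metis

text \<open>On a fine division the errors of the local approximations add up to at most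
  \<open>e' * (l b - l a)\<close>.\<close>

lemma primitive_along_imp_has_path_integral:
  assumes "a \<le> b" and vb: "variation_bound g a b l"
    and prim: "primitive_along (\<lambda>t. f (g t)) (\<lambda>t. h (g t)) g a b l"
  shows "has_path_integral h (f (g b) - f (g a)) (a, b, g)"
  unfolding has_path_integral.simps
proof (intro allI impI)
  fix e :: real assume "e > 0"
  have L: "0 \<le> l b - l a" using variation_bound_mono[OF vb] \<open>a \<le> b\<close> by simp
  define e' where "e' = e / (l b - l a + 1)"
  have "e' > 0" using L \<open>e > 0\<close> by (simp add: e'_def)
  have "e' * (l b - l a) < e" using L \<open>e > 0\<close> by (simp add: e'_def divide_simps)
  from primitive_alongD[OF prim \<open>e' > 0\<close>] obtain r where r: "r > 0"
    "\<And>c t d. a \<le> c \<Longrightarrow> c \<le> t \<Longrightarrow> t \<le> d \<Longrightarrow> d \<le> b \<Longrightarrow> d - c < r \<Longrightarrow>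
        norm (f (g d) - f (g c) - h (g t) * (g d - g c)) \<le> e' * (l d - l c)" by metis
  show "\<exists>r>0. \<forall>p. p tagged_division_of {a..b} \<and> (\<lambda>t. ball t r) fine p \<longrightarrow>
        norm ((\<Sum>(t, K)\<in>p. h (g t) * (g (Sup K) - g (Inf K))) - (f (g b) - f (g a))) < e"
  \<comment> \<open>A piece inside a ball of radius \<open>r / 2\<close> is shorter than
    \<open>r\<close>.\<close>
  proof (intro exI[of _ "r / 2"] conjI allI impI)
    fix p assume p: "p tagged_division_of {a..b} \<and> (\<lambda>t. ball t (r / 2)) fine p"
    then have td: "p tagged_division_of {a..b}" by simp
    have "f (g b) - f (g a) = (\<Sum>(t, K)\<in>p. f (g (Sup K)) - f (g (Inf K)))"
      using additive_tagged_division_1[OF \<open>a \<le> b\<close> td, of "\<lambda>t. f (g t)"] by simp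
    then have "norm ((\<Sum>(t, K)\<in>p. h (g t) * (g (Sup K) - g (Inf K))) - (f (g b) - f (g a)))
       = norm (\<Sum>(t, K)\<in>p. f (g (Sup K)) - f (g (Inf K)) - h (g t) * (g (Sup K) - g (Inf K)))"
      by (simp add: case_prod_unfold sum_subtractf norm_minus_commute)
    also have "\<dots> \<le> (\<Sum>(t, K)\<in>p. e' * (l (Sup K) - l (Inf K)))"
      unfolding case_prod_unfold
    proof (rule sum_norm_le)
      fix q assume "q \<in> p"
      then have q: "(fst q, snd q) \<in> p" by simp
      note el = tagged_division_of_interval_elem[OF td q]
      have "{Inf (snd q), Sup (snd q)} \<subseteq> snd q" using el(1,3,4)
        by (metis (no_types, lifting) atLeastAtMost_iff empty_subsetI insert_subset order.refl order.trans)
      then have "{Inf (snd q), Sup (snd q)} \<subseteq> ball (fst q) (r / 2)"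
        using p q unfolding fine_def by fast
      then have "\<bar>fst q - Inf (snd q)\<bar> < r / 2" "\<bar>fst q - Sup (snd q)\<bar> < r / 2"
        by (auto simp: dist_real_def)
      then have "Sup (snd q) - Inf (snd q) < r" by linarith
      with el show "norm (f (g (Sup (snd q))) - f (g (Inf (snd q))) - h (g (fst q)) * (g (Sup (snd q)) - g (Inf (snd q))))
          \<le> e' * (l (Sup (snd q)) - l (Inf (snd q)))"
        by (intro r(2)) auto
    qed
    also have "\<dots> = e' * (l b - l a)"
      unfolding additive_tagged_division_1[OF \<open>a \<le> b\<close> td, of l, symmetric]
      by (simp add: sum_distrib_left case_prod_unfold)
    finally show "norm ((\<Sum>(t, K)\<in>p. h (g t) * (g (Sup K) - g (Inf K))) - (f (g b) - f (g a))) < e"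
      using \<open>e' * (l b - l a) < e\<close> by linarith
  qed (use r in auto)
qed

lemma uniformly_close_on_interval:
  fixes \<phi> :: "real \<Rightarrow> 'a::real_normed_vector"
  assumes "continuous_on {a..b} \<phi>" "0 < e"
  obtains r where "r > 0" "\<And>s t. s \<in> {a..b} \<Longrightarrow> t \<in> {a..b} \<Longrightarrow> \<bar>s - t\<bar> < r \<Longrightarrow> norm (\<phi> s - \<phi> t) < e"
  using compact_uniformly_continuous[OF assms(1)] assms(2)
  unfolding uniformly_continuous_on_def dist_norm real_norm_def
  by (metis abs_minus_commute compact_Icc norm_minus_commute)

text \<open>By uniform continuity \<open>h (g s)\<close> stays within \<open>e\<close> of
  \<open>h (g t)\<close> on short intervals, so \<open>has_path_integral_bound\<close> applies with
  \<open>w = h (g t)\<close>.\<close>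

lemma primitive_along_if_has_path_integral:
  assumes vb: "variation_bound g a b l" and h: "continuous_on {a..b} (\<lambda>t. h (g t))"
    and int: "\<And>c d. a \<le> c \<Longrightarrow> c < d \<Longrightarrow> d \<le> b \<Longrightarrow>
      has_path_integral h (f (g d) - f (g c)) (c, d, restrict g {c..d})"
  shows "primitive_along (\<lambda>t. f (g t)) (\<lambda>t. h (g t)) g a b l"
  unfolding primitive_along_def
proof (intro allI impI)
  fix e :: real assume "e > 0"
  with h obtain r where r: "r > 0"
    "\<And>s t. s \<in> {a..b} \<Longrightarrow> t \<in> {a..b} \<Longrightarrow> \<bar>s - t\<bar> < r \<Longrightarrow> norm (h (g s) - h (g t)) < e"
    using uniformly_close_on_interval by (metis (no_types, lifting))
  have "norm (f (g d) - f (g c) - h (g t) * (g d - g c)) \<le> e * (l d - l c)"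
    if t: "a \<le> c" "c \<le> t" "t \<le> d" "d \<le> b" "d - c < r" for c t d
  proof (cases "c = d")
    case False
    with t have "c < d" by simp
    have "variation_bound (restrict g {c..d}) c d l"
      using variation_bound_subinterval[OF vb t(1,4)] by (simp add: variation_bound_def)
    moreover have "norm (h (restrict g {c..d} s) - h (g t)) \<le> e" if "s \<in> {c..d}" for s
      using r(2)[of s t] that t by force
    ultimately have "norm (f (g d) - f (g c) - h (g t) * (restrict g {c..d} d - restrict g {c..d} c)) \<le> e * (l d - l c)"
      using t(1,4) \<open>c < d\<close> by (intro has_path_integral_bound[OF int]) auto
    with \<open>c < d\<close> show ?thesis by simp
  qed auto
  with r(1) show "\<exists>r>0. \<forall>c t d. a \<le> c \<longrightarrow> c \<le> t \<longrightarrow> t \<le> d \<longrightarrow> d \<le> b \<longrightarrow> d - c < r \<longrightarrow>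
        norm (f (g d) - f (g c) - h (g t) * (g d - g c)) \<le> e * (l d - l c)" by blast
qed

section \<open>Sums, products and uniqueness for primitives along a path\<close>

lemma primitive_along_const:
  assumes "variation_bound g a b l"
  shows "primitive_along (\<lambda>_. c) (\<lambda>_. 0) g a b l"
  using variation_bound_mono[OF assms] by (auto simp: primitive_along_def intro!: exI[of _ 1])

lemma primitive_along_add:
  assumes "primitive_along \<phi> h g a b l" "primitive_along \<psi> k g a b l"
  shows "primitive_along (\<lambda>t. \<phi> t + \<psi> t) (\<lambda>t. h t + k t) g a b l"
  unfolding primitive_along_def
proof (intro allI impI)
  fix e :: real assume "e > 0"
  then have "e / 2 > 0" by simp
  from primitive_alongD[OF assms(1) this] obtain r1 where r1: "r1 > 0"
    "\<And>c t d. a \<le> c \<Longrightarrow> c \<le> t \<Longrightarrow> t \<le> d \<Longrightarrow> d \<le> b \<Longrightarrow> d - c < r1 \<Longrightarrow>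
        norm (\<phi> d - \<phi> c - h t * (g d - g c)) \<le> e / 2 * (l d - l c)" by metis
  from primitive_alongD[OF assms(2) \<open>e / 2 > 0\<close>] obtain r2 where r2: "r2 > 0"
    "\<And>c t d. a \<le> c \<Longrightarrow> c \<le> t \<Longrightarrow> t \<le> d \<Longrightarrow> d \<le> b \<Longrightarrow> d - c < r2 \<Longrightarrow>
        norm (\<psi> d - \<psi> c - k t * (g d - g c)) \<le> e / 2 * (l d - l c)" by metis
  show "\<exists>r>0. \<forall>c t d. a \<le> c \<longrightarrow> c \<le> t \<longrightarrow> t \<le> d \<longrightarrow> d \<le> b \<longrightarrow> d - c < r \<longrightarrow>
        norm (\<phi> d + \<psi> d - (\<phi> c + \<psi> c) - (h t + k t) * (g d - g c)) \<le> e * (l d - l c)"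
  proof (intro exI[of _ "min r1 r2"] conjI allI impI)
    fix c t d assume t: "a \<le> c" "c \<le> t" "t \<le> d" "d \<le> b" "d - c < min r1 r2"
    have "norm ((\<phi> d - \<phi> c - h t * (g d - g c)) + (\<psi> d - \<psi> c - k t * (g d - g c)))
      \<le> e / 2 * (l d - l c) + e / 2 * (l d - l c)"
      using t by (intro norm_triangle_mono r1(2) r2(2)) auto
    then show "norm (\<phi> d + \<psi> d - (\<phi> c + \<psi> c) - (h t + k t) * (g d - g c)) \<le> e * (l d - l c)"
      by (simp add: algebra_simps)
  qed (use r1 r2 in auto)
qed

lemma continuous_on_interval_bounded:
  fixes \<phi> :: "real \<Rightarrow> 'a::real_normed_vector"
  assumes "continuous_on {a..b} \<phi>"
  obtains B where "0 < B" "\<And>t. t \<in> {a..b} \<Longrightarrow> norm (\<phi> t) \<le> B"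
  using compact_imp_bounded[OF compact_continuous_image[OF assms compact_Icc]]
  unfolding bounded_pos by auto

lemma primitive_along_mult:
  assumes vb: "variation_bound g a b l"
    and prim: "primitive_along \<phi> h g a b l" "primitive_along \<psi> k g a b l"
    and cont: "continuous_on {a..b} \<phi>" "continuous_on {a..b} h"
      "continuous_on {a..b} \<psi>" "continuous_on {a..b} k"
  shows "primitive_along (\<lambda>t. \<phi> t * \<psi> t) (\<lambda>t. \<phi> t * k t + h t * \<psi> t) g a b l"
  unfolding primitive_along_def
proof (intro allI impI)
  fix e :: real assume "e > 0"
  obtain B1 B2 B3 B4 where B': "0 < B1" "\<And>t. t \<in> {a..b} \<Longrightarrow> norm (\<phi> t) \<le> B1"
    "0 < B2" "\<And>t. t \<in> {a..b} \<Longrightarrow> norm (h t) \<le> B2"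
    "0 < B3" "\<And>t. t \<in> {a..b} \<Longrightarrow> norm (\<psi> t) \<le> B3"
    "0 < B4" "\<And>t. t \<in> {a..b} \<Longrightarrow> norm (k t) \<le> B4"
    using continuous_on_interval_bounded cont by metis
  define B where "B = B1 + B2 + B3 + B4"
  have B: "B > 0" "norm (\<phi> t) \<le> B" "norm (h t) \<le> B" "norm (\<psi> t) \<le> B" "norm (k t) \<le> B"
    if "t \<in> {a..b}" for t
    using B'(1,3,5,7) B'(2,4,6,8)[OF that] unfolding B_def by linarith+
  have "B > 0" using B'(1,3,5,7) by (simp add: B_def)
  \<comment> \<open>The error for the product consists of four terms, each at most
    \<open>B * e' * (l d - l c)\<close>.\<close>
  define e' where "e' = e / (4 * B)"
  have "e' > 0" using \<open>e > 0\<close> \<open>B > 0\<close> by (simp add: e'_def)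
  have e': "e = B * e' + B * e' + e' * B + e' * B" using \<open>B > 0\<close> by (simp add: e'_def)
  from primitive_alongD[OF prim(1) \<open>e' > 0\<close>] obtain r1 where r1: "r1 > 0"
    "\<And>c t d. a \<le> c \<Longrightarrow> c \<le> t \<Longrightarrow> t \<le> d \<Longrightarrow> d \<le> b \<Longrightarrow> d - c < r1 \<Longrightarrow>
        norm (\<phi> d - \<phi> c - h t * (g d - g c)) \<le> e' * (l d - l c)" by metis
  from primitive_alongD[OF prim(2) \<open>e' > 0\<close>] obtain r2 where r2: "r2 > 0"
    "\<And>c t d. a \<le> c \<Longrightarrow> c \<le> t \<Longrightarrow> t \<le> d \<Longrightarrow> d \<le> b \<Longrightarrow> d - c < r2 \<Longrightarrow>
        norm (\<psi> d - \<psi> c - k t * (g d - g c)) \<le> e' * (l d - l c)" by metis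
  obtain r3 where r3: "r3 > 0" "\<And>s t. s \<in> {a..b} \<Longrightarrow> t \<in> {a..b} \<Longrightarrow> \<bar>s - t\<bar> < r3 \<Longrightarrow> norm (\<phi> s - \<phi> t) < e'"
    using uniformly_close_on_interval[OF cont(1) \<open>e' > 0\<close>] by metis
  obtain r4 where r4: "r4 > 0" "\<And>s t. s \<in> {a..b} \<Longrightarrow> t \<in> {a..b} \<Longrightarrow> \<bar>s - t\<bar> < r4 \<Longrightarrow> norm (\<psi> s - \<psi> t) < e'"
    using uniformly_close_on_interval[OF cont(3) \<open>e' > 0\<close>] by metis
  show "\<exists>r>0. \<forall>c t d. a \<le> c \<longrightarrow> c \<le> t \<longrightarrow> t \<le> d \<longrightarrow> d \<le> b \<longrightarrow> d - c < r \<longrightarrow>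
        norm (\<phi> d * \<psi> d - \<phi> c * \<psi> c - (\<phi> t * k t + h t * \<psi> t) * (g d - g c)) \<le> e * (l d - l c)"
  proof (intro exI[of _ "min (min r1 r2) (min r3 r4)"] conjI allI impI)
    fix c t d assume t: "a \<le> c" "c \<le> t" "t \<le> d" "d \<le> b" "d - c < min (min r1 r2) (min r3 r4)"
    then have mem: "c \<in> {a..b}" "t \<in> {a..b}" "d \<in> {a..b}" by auto
    have \<Delta>: "norm (g d - g c) \<le> l d - l c" using t by (intro variation_boundD[OF vb]) auto
    \<comment> \<open>The first two terms come from splitting the increment of the product as
      \<open>\<phi> d * (\<psi> d - \<psi> c) + \<psi> c * (\<phi> d - \<phi> c)\<close>; the last
      two move the coefficients from the end points to the tag \<open>t\<close>.\<close>
    have "\<phi> d * \<psi> d - \<phi> c * \<psi> c - (\<phi> t * k t + h t * \<psi> t) * (g d - g c) =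
      \<phi> d * (\<psi> d - \<psi> c - k t * (g d - g c)) + \<psi> c * (\<phi> d - \<phi> c - h t * (g d - g c))
      + (\<phi> d - \<phi> t) * k t * (g d - g c) + (\<psi> c - \<psi> t) * h t * (g d - g c)"
      by (simp add: algebra_simps)
    also have "norm \<dots> \<le> B * (e' * (l d - l c)) + B * (e' * (l d - l c))
      + e' * B * (l d - l c) + e' * B * (l d - l c)"
      using t \<Delta> B[OF mem(1)] B[OF mem(2)] B[OF mem(3)] \<open>e' > 0\<close>
      by (intro norm_triangle_mono norm_mult_ineq[THEN order_trans] mult_mono r1(2) r2(2)
          less_imp_le[OF r3(2)] less_imp_le[OF r4(2)]) auto
    also have "\<dots> = e * (l d - l c)" unfolding e' by (simp add: algebra_simps)
    finally show "norm (\<phi> d * \<psi> d - \<phi> c * \<psi> c - (\<phi> t * k t + h t * \<psi> t) * (g d - g c)) \<le> e * (l d - l c)" .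
  qed (use r1 r2 r3 r4 in auto)
qed

text \<open>Where \<open>h\<close> stays away from 0, a vanishing primitive bounds the chords by
  half the growth of \<open>l\<close>. Halving this growth leaves a variation bound, so by
  minimality there was none; then \<open>g\<close> is constant on an interval, which is
  excluded.\<close>

lemma primitive_along_zero_unique:
  assumes arc: "arc_length_on g a b l" and "a < b"
    and nonconst: "\<And>c d. a \<le> c \<Longrightarrow> c < d \<Longrightarrow> d \<le> b \<Longrightarrow> \<not> g constant_on {c..d}"
    and prim: "primitive_along (\<lambda>_. 0) h g a b l" and h: "continuous_on {a..b} h"
    and s: "s \<in> {a..b}"
  shows "h s = 0"
proof (rule ccontr)
  assume "h s \<noteq> 0"
  \<comment> \<open>Near \<open>s\<close> the norm of \<open>h\<close> is at least this
    \<open>w\<close>, so the tolerance \<open>w / 2\<close> yields exactly the factor one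
    half.\<close>
  define w where "w = norm (h s) / 2"
  have "w > 0" using \<open>h s \<noteq> 0\<close> by (simp add: w_def)
  then have "w / 2 > 0" by simp
  from primitive_alongD[OF prim this] obtain r1 where r1: "r1 > 0"
    "\<And>c t d. a \<le> c \<Longrightarrow> c \<le> t \<Longrightarrow> t \<le> d \<Longrightarrow> d \<le> b \<Longrightarrow> d - c < r1 \<Longrightarrow>
        norm (h t * (g d - g c)) \<le> w / 2 * (l d - l c)" by (metis (no_types, lifting) diff_zero diff_0 norm_minus_cancel)
  obtain r2 where r2: "r2 > 0" "\<And>s t. s \<in> {a..b} \<Longrightarrow> t \<in> {a..b} \<Longrightarrow> \<bar>s - t\<bar> < r2 \<Longrightarrow> norm (h s - h t) < w"
    using uniformly_close_on_interval[OF h \<open>w > 0\<close>] by metis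
  define r where "r = min r1 r2 / 3"
  have r: "r > 0" "2 * r < r1" "r < r2" using r1(1) r2(1) by (auto simp: r_def)
  define c where "c = max a (s - r)"
  define d where "d = min b (s + r)"
  have cd: "a \<le> c" "c < d" "d \<le> b" "c \<le> s" "s \<le> d" "d - c < r1"
    using s \<open>a < b\<close> r by (auto simp: c_def d_def max_def min_def)
  have vb: "variation_bound g a b l" using arc by (simp add: arc_length_on_def)
  have half: "norm (g y - g x) \<le> (l y - l x) / 2" if xy: "c \<le> x" "x \<le> y" "y \<le> d" for x y
  proof -
    have "norm (h s - h x) < w"
      using xy cd s r by (intro r2(2)) (auto simp: c_def d_def)
    then have "w \<le> norm (h x)"
      using norm_triangle_ineq2[of "h s" "h x"] by (simp add: w_def)
    then have "w * norm (g y - g x) \<le> norm (h x * (g y - g x))"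
      by (simp add: norm_mult mult_right_mono)
    also have "\<dots> \<le> w / 2 * (l y - l x)"
      using xy cd by (intro r1(2)) auto
    finally have "w * norm (g y - g x) \<le> w * ((l y - l x) / 2)" by simp
    with \<open>w > 0\<close> show ?thesis by (simp only: mult_le_cancel_left_pos)
  qed
  \<comment> \<open>\<open>m\<close> grows half as fast as \<open>l\<close> on \<open>{c..d}\<close>
    and at the same rate outside.\<close>
  define m where "m t = l t - (l (max c (min d t)) - l c) / 2" for t
  have m: "t \<le> c \<Longrightarrow> m t = l t" "c \<le> t \<Longrightarrow> t \<le> d \<Longrightarrow> m t = (l t + l c) / 2"
    "d \<le> t \<Longrightarrow> m t = l t - (l d - l c) / 2" for t
    using cd by (auto simp: m_def max_def min_def field_simps)
  have "variation_bound g a c m"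
    unfolding variation_bound_def using variation_boundD[OF vb] cd by (auto simp: m(1))
  moreover have "variation_bound g c d m"
    unfolding variation_bound_def
  proof (intro allI impI)
    fix x y assume "c \<le> x" "x \<le> y" "y \<le> d"
    moreover from this have "m y - m x = (l y - l x) / 2"
      using cd by (simp add: m(2) field_simps)
    ultimately show "norm (g y - g x) \<le> m y - m x" using half[of x y] by simp
  qed
  moreover have "variation_bound g d b m"
    unfolding variation_bound_def
  proof (intro allI impI)
    fix x y assume "d \<le> x" "x \<le> y" "y \<le> b"
    moreover from this have "m y - m x = l y - l x"
      using cd by (simp add: m(3))
    ultimately show "norm (g y - g x) \<le> m y - m x" using variation_boundD[OF vb, of x y] cd by simp
  qed
  ultimately have "variation_bound g a b m" by (blast intro: variation_bound_concat)
  with arc have "l b - l a \<le> m b - m a" by (auto simp: arc_length_on_def)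
  then have "l d \<le> l c" using cd by (simp add: m(1)[of a] m(3)[of b])
  have "g x = g c" if "x \<in> {c..d}" for x
  proof -
    have "l x \<le> l d" using that cd by (intro variation_bound_mono[OF vb]) auto
    with \<open>l d \<le> l c\<close> have "(l x - l c) / 2 \<le> 0" by simp
    moreover have "norm (g x - g c) \<le> (l x - l c) / 2" using that by (intro half) auto
    ultimately have "norm (g x - g c) \<le> 0" by (rule order_trans[rotated])
    then show ?thesis by simp
  qed
  then have "g constant_on {c..d}" unfolding constant_on_def by blast
  with nonconst[OF cd(1-3)] show False by simp
qed

subsection \<open>Derivatives with respect to a family of paths\<close>

text \<open>Collects what effectiveness says about a single path. The arc length comes from
  rectifiability; closure under subpaths is what makes integral conditions local.\<close>

lemma effective_path:
  assumes "effective X F" "(a, b, g) \<in> F"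
  obtains l where "a < b" "continuous_on {a..b} g" "g ` {a..b} \<subseteq> X" "arc_length_on g a b l"
    "continuous_on {a..b} l" "variation_bound g a b l"
    "\<And>c d. a \<le> c \<Longrightarrow> c < d \<Longrightarrow> d \<le> b \<Longrightarrow> \<not> g constant_on {c..d}"
    "\<And>c d. a \<le> c \<Longrightarrow> c < d \<Longrightarrow> d \<le> b \<Longrightarrow> (c, d, restrict g {c..d}) \<in> F"
proof -
  have "(a, b, g) \<in> paths_in X" and adm: "admissible (a, b, g)" and sub: "subpaths (a, b, g) \<subseteq> F"
    using assms unfolding effective_def by blast+
  then have g: "a < b" "continuous_on {a..b} g" "g ` {a..b} \<subseteq> X"
    by (auto simp: paths_in_def plane_paths_def)
  from adm g(1) obtain l where l: "arc_length_on g a b l"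
    using arc_length_exists[of a b g] by (auto simp: admissible_def)
  have "\<not> g constant_on {c..d}" if "a \<le> c" "c < d" "d \<le> b" for c d
  proof -
    have "\<not> constant_path (c, d, restrict g {c..d})"
      using adm that by (auto simp: admissible_def)
    then show ?thesis by (auto simp: constant_on_def)
  qed
  moreover have "(c, d, restrict g {c..d}) \<in> F" if "a \<le> c" "c < d" "d \<le> b" for c d
    using sub that by auto
  ultimately show ?thesis
    using that[OF g l continuous_on_arc_length[OF l less_imp_le[OF g(1)] g(2)]] l
    by (simp add: arc_length_on_def)
qed

lemma cont_funs_on_path:
  assumes "h \<in> cont_funs X" "continuous_on {a..b} g" "g ` {a..b} \<subseteq> X"
  shows "continuous_on {a..b} (\<lambda>t. h (g t))"
  using assms by (auto simp: cont_funs_def intro: continuous_on_compose2)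

lemma has_F_deriv_subpath:
  assumes eff: "effective X F" and f: "has_F_deriv X F f f'" and path: "(a, b, g) \<in> F"
    and cd: "a \<le> c" "c < d" "d \<le> b"
  shows "has_path_integral f' (f (g d) - f (g c)) (c, d, restrict g {c..d})"
proof -
  have "(c, d, restrict g {c..d}) \<in> F"
    using effective_path[OF eff path] cd by metis
  with f have "has_path_integral f' (f (end_point (c, d, restrict g {c..d}))
      - f (start_point (c, d, restrict g {c..d}))) (c, d, restrict g {c..d})"
    unfolding has_F_deriv_def by blast
  with \<open>c < d\<close> show ?thesis by (simp del: has_path_integral.simps)
qed

lemma has_F_deriv_imp_primitive_along:
  assumes eff: "effective X F" and f: "has_F_deriv X F f f'" and path: "(a, b, g) \<in> F"
    and vb: "variation_bound g a b l"
  shows "primitive_along (\<lambda>t. f (g t)) (\<lambda>t. f' (g t)) g a b l"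
proof (rule primitive_along_if_has_path_integral[OF vb])
  have "continuous_on {a..b} g" "g ` {a..b} \<subseteq> X"
    using effective_path[OF eff path] by metis+
  with f show "continuous_on {a..b} (\<lambda>t. f' (g t))"
    by (auto simp: has_F_deriv_def intro: cont_funs_on_path)
qed (rule has_F_deriv_subpath[OF eff f path])

text \<open>The arc length needed to return from local estimates to the integral comes from
  \<open>effective_path\<close>, so it suffices to treat an arbitrary variation bound.\<close>

lemma has_F_derivI:
  assumes eff: "effective X F" and "f' \<in> cont_funs X"
    and prim: "\<And>a b g l. (a, b, g) \<in> F \<Longrightarrow> variation_bound g a b l \<Longrightarrow> continuous_on {a..b} g \<Longrightarrow>
      g ` {a..b} \<subseteq> X \<Longrightarrow> primitive_along (\<lambda>t. f (g t)) (\<lambda>t. f' (g t)) g a b l"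
  shows "has_F_deriv X F f f'"
  unfolding has_F_deriv_def
proof (intro conjI ballI)
  fix \<gamma> assume "\<gamma> \<in> F"
  then obtain a b g where \<gamma>: "\<gamma> = (a, b, g)" "(a, b, g) \<in> F" by (metis prod_cases3)
  obtain l where g: "a < b" "continuous_on {a..b} g" "g ` {a..b} \<subseteq> X" "variation_bound g a b l"
    using effective_path[OF eff \<gamma>(2)] by metis
  then have "has_path_integral f' (f (g b) - f (g a)) (a, b, g)"
    by (intro primitive_along_imp_has_path_integral[OF _ g(4)] prim \<gamma>(2)) auto
  then show "has_path_integral f' (f (end_point \<gamma>) - f (start_point \<gamma>)) \<gamma>"
    by (simp add: \<gamma>(1) del: has_path_integral.simps)
qed fact

lemma primitive_along_cong:
  assumes "\<And>t. t \<in> {a..b} \<Longrightarrow> \<phi> t = \<psi> t" "\<And>t. t \<in> {a..b} \<Longrightarrow> h t = k t"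
    "primitive_along \<phi> h g a b l"
  shows "primitive_along \<psi> k g a b l"
  unfolding primitive_along_def
proof (intro allI impI)
  fix e :: real assume "e > 0"
  from primitive_alongD[OF assms(3) this] obtain r where r: "r > 0"
    "\<And>c t d. a \<le> c \<Longrightarrow> c \<le> t \<Longrightarrow> t \<le> d \<Longrightarrow> d \<le> b \<Longrightarrow> d - c < r \<Longrightarrow>
        norm (\<phi> d - \<phi> c - h t * (g d - g c)) \<le> e * (l d - l c)" by metis
  have "norm (\<psi> d - \<psi> c - k t * (g d - g c)) \<le> e * (l d - l c)"
    if "a \<le> c" "c \<le> t" "t \<le> d" "d \<le> b" "d - c < r" for c t d
  proof -
    have eq: "\<phi> c = \<psi> c" "\<phi> d = \<psi> d" "h t = k t"
      using that by (intro assms(1,2); simp)+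
    show ?thesis using r(2)[OF that] unfolding eq .
  qed
  with r(1) show "\<exists>r>0. \<forall>c t d. a \<le> c \<longrightarrow> c \<le> t \<longrightarrow> t \<le> d \<longrightarrow> d \<le> b \<longrightarrow> d - c < r \<longrightarrow>
        norm (\<psi> d - \<psi> c - k t * (g d - g c)) \<le> e * (l d - l c)" by blast
qed

text \<open>Along each path the difference of the candidates has primitive 0, so it vanishes there.
  The traces are dense and the candidates continuous, so they agree on \<open>X\<close>, and outside
  \<open>X\<close> by extensionality.\<close>

lemma has_F_deriv_unique:
  assumes eff: "effective X F" and f1: "has_F_deriv X F f f1" and f2: "has_F_deriv X F f f2"
  shows "f1 = f2"
proof -
  have c: "f1 \<in> cont_funs X" "f2 \<in> cont_funs X" using f1 f2 by (auto simp: has_F_deriv_def)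
  have tr: "f1 z = f2 z" if "\<gamma> \<in> F" "z \<in> path_trace \<gamma>" for \<gamma> z
  proof -
    obtain a b g where \<gamma>: "\<gamma> = (a, b, g)" by (cases \<gamma>)
    with that obtain s where g: "(a, b, g) \<in> F" "s \<in> {a..b}" "z = g s" by auto
    obtain l where l: "a < b" "continuous_on {a..b} g" "g ` {a..b} \<subseteq> X" "arc_length_on g a b l"
      "variation_bound g a b l"
      "\<And>c d. a \<le> c \<Longrightarrow> c < d \<Longrightarrow> d \<le> b \<Longrightarrow> \<not> g constant_on {c..d}"
      using effective_path[OF eff g(1)] by metis
    have p1: "primitive_along (\<lambda>t. f (g t)) (\<lambda>t. f1 (g t)) g a b l"
      by (rule has_F_deriv_imp_primitive_along[OF eff f1 g(1) l(5)])
    have p2: "primitive_along (\<lambda>t. f (g t)) (\<lambda>t. f2 (g t)) g a b l"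
      by (rule has_F_deriv_imp_primitive_along[OF eff f2 g(1) l(5)])
    have "primitive_along (\<lambda>_. 0) (\<lambda>t. f1 (g t) - f2 (g t)) g a b l"
      unfolding primitive_along_def
    proof (intro allI impI)
      fix e :: real assume "e > 0"
      then have "e / 2 > 0" by simp
      from primitive_alongD[OF p1 this] obtain r1 where r1: "r1 > 0"
        "\<And>c t d. a \<le> c \<Longrightarrow> c \<le> t \<Longrightarrow> t \<le> d \<Longrightarrow> d \<le> b \<Longrightarrow> d - c < r1 \<Longrightarrow>
            norm (f (g d) - f (g c) - f1 (g t) * (g d - g c)) \<le> e / 2 * (l d - l c)" by metis
      from primitive_alongD[OF p2 \<open>e / 2 > 0\<close>] obtain r2 where r2: "r2 > 0"
        "\<And>c t d. a \<le> c \<Longrightarrow> c \<le> t \<Longrightarrow> t \<le> d \<Longrightarrow> d \<le> b \<Longrightarrow> d - c < r2 \<Longrightarrow>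
            norm (f (g d) - f (g c) - f2 (g t) * (g d - g c)) \<le> e / 2 * (l d - l c)" by metis
      show "\<exists>r>0. \<forall>c t d. a \<le> c \<longrightarrow> c \<le> t \<longrightarrow> t \<le> d \<longrightarrow> d \<le> b \<longrightarrow> d - c < r \<longrightarrow>
        norm (0 - 0 - (f1 (g t) - f2 (g t)) * (g d - g c)) \<le> e * (l d - l c)"
      proof (intro exI[of _ "min r1 r2"] conjI allI impI)
        fix c t d assume t: "a \<le> c" "c \<le> t" "t \<le> d" "d \<le> b" "d - c < min r1 r2"
        have "norm ((f (g d) - f (g c) - f1 (g t) * (g d - g c)) - (f (g d) - f (g c) - f2 (g t) * (g d - g c)))
          \<le> e / 2 * (l d - l c) + e / 2 * (l d - l c)"
          using t by (intro order_trans[OF norm_triangle_ineq4] add_mono r1(2) r2(2)) auto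
        then show "norm (0 - 0 - (f1 (g t) - f2 (g t)) * (g d - g c)) \<le> e * (l d - l c)"
          by (simp add: algebra_simps)
      qed (use r1 r2 in auto)
    qed
    moreover have "continuous_on {a..b} (\<lambda>t. f1 (g t) - f2 (g t))"
      by (intro continuous_on_diff cont_funs_on_path[OF _ l(2,3)] c)
    ultimately have "f1 (g s) - f2 (g s) = 0"
      using primitive_along_zero_unique[OF l(4,1) _ _ _ g(2), of "\<lambda>t. f1 (g t) - f2 (g t)"] l(6) by blast
    then show ?thesis by (simp add: g(3))
  qed
  define E where "E = {z \<in> X. f1 z - f2 z = 0}"
  have X: "compact X" "X \<subseteq> closure (\<Union>\<gamma>\<in>F. path_trace \<gamma>)" "F \<subseteq> paths_in X"
    using eff unfolding effective_def by blast+
  have "closed E"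
    unfolding E_def using c X(1)
    by (intro continuous_closed_preimage_constant continuous_on_diff) (auto simp: cont_funs_def compact_imp_closed)
  moreover have "(\<Union>\<gamma>\<in>F. path_trace \<gamma>) \<subseteq> E"
    using tr X(3) by (auto simp: E_def paths_in_def)
  ultimately have "X \<subseteq> E" using X(2) closure_minimal by blast
  then show ?thesis
    using c by (intro extensionalityI[of _ X]) (auto simp: cont_funs_def E_def)
qed

section \<open>Iterated derivatives\<close>

lemma F_deriv_eq: "effective X F \<Longrightarrow> has_F_deriv X F f f' \<Longrightarrow> F_deriv X F f = f'"
  unfolding F_deriv_def by (blast intro: the_equality has_F_deriv_unique)

lemma F_deriv_n_Suc: "F_deriv_n X F (Suc n) f = F_deriv_n X F n (F_deriv X F f)"
  by (simp add: F_deriv_n_def funpow_swap1)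

text \<open>Uniqueness turns the recursion through a definite description into a chain of relations.
  The order is \<open>Suc n\<close> because \<open>D_F X F 0\<close> is only a convention.\<close>

lemma D_F_Suc_iff:
  assumes eff: "effective X F"
  shows "f \<in> D_F X F (Suc n) \<longleftrightarrow>
    f \<in> cont_funs X \<and> (\<forall>k\<le>n. has_F_deriv X F (F_deriv_n X F k f) (F_deriv_n X F (Suc k) f))"
proof (induction n arbitrary: f)
  case 0
  then show ?case using F_deriv_eq[OF eff] by (auto simp: F_deriv_n_def)
next
  case (Suc n)
  have 1: "f \<in> D_F X F (Suc 0) \<longleftrightarrow> f \<in> cont_funs X \<and> has_F_deriv X F f (F_deriv X F f)"
    using F_deriv_eq[OF eff] by auto
  have "f \<in> D_F X F (Suc (Suc n)) \<longleftrightarrow> f \<in> D_F X F (Suc 0) \<and> F_deriv X F f \<in> D_F X F (Suc n)"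
    by simp
  also have "\<dots> \<longleftrightarrow> f \<in> cont_funs X \<and> has_F_deriv X F f (F_deriv X F f) \<and>
      (\<forall>k\<le>n. has_F_deriv X F (F_deriv_n X F (Suc k) f) (F_deriv_n X F (Suc (Suc k)) f))"
    unfolding Suc.IH 1 F_deriv_n_Suc[symmetric] by (auto simp: has_F_deriv_def)
  also have "\<dots> \<longleftrightarrow> f \<in> cont_funs X \<and>
      (\<forall>k\<le>Suc n. has_F_deriv X F (F_deriv_n X F k f) (F_deriv_n X F (Suc k) f))"
  proof -
    have "(\<forall>k\<le>Suc n. P k) \<longleftrightarrow> P 0 \<and> (\<forall>k\<le>n. P (Suc k))" for P
      using All_less_Suc2[of "Suc n" P] by (simp add: less_Suc_eq_le)
    from this[of "\<lambda>k. has_F_deriv X F (F_deriv_n X F k f) (F_deriv_n X F (Suc k) f)"]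
    show ?thesis by (simp add: F_deriv_n_def)
  qed
  finally show ?case .
qed

lemma D_F_inf_iff:
  assumes "effective X F"
  shows "f \<in> D_F_inf X F \<longleftrightarrow>
    f \<in> cont_funs X \<and> (\<forall>n. has_F_deriv X F (F_deriv_n X F n f) (F_deriv_n X F (Suc n) f))"
proof -
  have "f \<in> D_F_inf X F \<longleftrightarrow> (\<forall>n. f \<in> D_F X F (Suc n))"
    unfolding D_F_inf_def by (metis INT_iff atLeast_iff le_add1 not0_implies_Suc not_one_le_zero plus_1_eq_Suc)
  then show ?thesis unfolding D_F_Suc_iff[OF assms] by blast
qed

lemma F_deriv_n_cont_funs:
  assumes "effective X F" "f \<in> D_F_inf X F"
  shows "F_deriv_n X F n f \<in> cont_funs X"
proof (cases n)
  case 0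
  then show ?thesis using assms(2)[unfolded D_F_inf_iff[OF assms(1)]] by (simp add: F_deriv_n_def)
next
  case (Suc m)
  then show ?thesis using assms(2)[unfolded D_F_inf_iff[OF assms(1)]] unfolding has_F_deriv_def by blast
qed

text \<open>By uniqueness any chain of successive derivatives consists of the iterated derivatives
  of its first term. Sums, multiples and products are treated by exhibiting their chains.\<close>

lemma D_F_inf_chainI:
  assumes eff: "effective X F" and "G 0 \<in> cont_funs X" and G: "\<And>n. has_F_deriv X F (G n) (G (Suc n))"
  shows "G 0 \<in> D_F_inf X F" "F_deriv_n X F n (G 0) = G n"
proof -
  have eq: "F_deriv_n X F n (G 0) = G n" for n
    by (induction n) (simp_all add: F_deriv_n_def F_deriv_eq[OF eff G])
  then show "F_deriv_n X F n (G 0) = G n" .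
  show "G 0 \<in> D_F_inf X F"
    unfolding D_F_inf_iff[OF eff] eq using assms by blast
qed

section \<open>Rules of differentiation\<close>

lemma primitive_along_restrict:
  assumes "g ` {a..b} \<subseteq> X" "primitive_along (\<lambda>t. f (g t)) (\<lambda>t. h (g t)) g a b l"
  shows "primitive_along (\<lambda>t. restrict f X (g t)) (\<lambda>t. restrict h X (g t)) g a b l"
proof (rule primitive_along_cong[OF _ _ assms(2)])
  fix t assume "t \<in> {a..b}"
  then have "g t \<in> X" using assms(1) by blast
  then show "f (g t) = restrict f X (g t)" "h (g t) = restrict h X (g t)" by simp_all
qed

lemma has_F_deriv_const:
  assumes "effective X F"
  shows "has_F_deriv X F (\<lambda>z\<in>X. c) (\<lambda>z\<in>X. 0)"
proof (rule has_F_derivI[OF assms])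
  show "primitive_along (\<lambda>t. (\<lambda>z\<in>X. c) (g t)) (\<lambda>t. (\<lambda>z\<in>X. 0) (g t)) g a b l"
    if "variation_bound g a b l" "g ` {a..b} \<subseteq> X" for a b g l
    by (rule primitive_along_restrict[OF that(2) primitive_along_const[OF that(1)]])
qed (auto simp: cont_funs_def intro: continuous_on_eq[OF continuous_on_const])

lemma restrict_cont_funs [intro]: "continuous_on X f \<Longrightarrow> restrict f X \<in> cont_funs X"
  by (auto simp: cont_funs_def intro: continuous_on_eq)

lemma cont_funs_continuous: "f \<in> cont_funs X \<Longrightarrow> continuous_on X f"
  by (simp add: cont_funs_def)

lemma has_F_deriv_cont_funs: "has_F_deriv X F f f' \<Longrightarrow> f' \<in> cont_funs X"
  by (simp add: has_F_deriv_def)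

lemma has_F_deriv_add:
  assumes eff: "effective X F" and f: "has_F_deriv X F f f'" and g: "has_F_deriv X F g g'"
  shows "has_F_deriv X F (\<lambda>z\<in>X. f z + g z) (\<lambda>z\<in>X. f' z + g' z)"
proof (rule has_F_derivI[OF eff])
  show "(\<lambda>z\<in>X. f' z + g' z) \<in> cont_funs X"
    using f g unfolding has_F_deriv_def
    by (intro restrict_cont_funs continuous_on_add cont_funs_continuous) blast+
  fix a b \<gamma> l assume \<gamma>: "(a, b, \<gamma>) \<in> F" "variation_bound \<gamma> a b l" "continuous_on {a..b} \<gamma>" "\<gamma> ` {a..b} \<subseteq> X"
  show "primitive_along (\<lambda>t. (\<lambda>z\<in>X. f z + g z) (\<gamma> t)) (\<lambda>t. (\<lambda>z\<in>X. f' z + g' z) (\<gamma> t)) \<gamma> a b l"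
    by (rule primitive_along_restrict[OF \<gamma>(4) primitive_along_add[OF
        has_F_deriv_imp_primitive_along[OF eff f \<gamma>(1,2)] has_F_deriv_imp_primitive_along[OF eff g \<gamma>(1,2)]]])
qed

lemma has_F_deriv_mult:
  assumes eff: "effective X F" and f: "has_F_deriv X F f f'" and g: "has_F_deriv X F g g'"
    and c: "f \<in> cont_funs X" "g \<in> cont_funs X"
  shows "has_F_deriv X F (\<lambda>z\<in>X. f z * g z) (\<lambda>z\<in>X. f z * g' z + f' z * g z)"
proof (rule has_F_derivI[OF eff])
  note c' = c f[THEN has_F_deriv_cont_funs] g[THEN has_F_deriv_cont_funs]
  then show "(\<lambda>z\<in>X. f z * g' z + f' z * g z) \<in> cont_funs X"
    by (intro restrict_cont_funs continuous_on_add continuous_on_mult cont_funs_continuous)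
  fix a b \<gamma> l assume \<gamma>: "(a, b, \<gamma>) \<in> F" "variation_bound \<gamma> a b l" "continuous_on {a..b} \<gamma>" "\<gamma> ` {a..b} \<subseteq> X"
  have "primitive_along (\<lambda>t. f (\<gamma> t) * g (\<gamma> t)) (\<lambda>t. f (\<gamma> t) * g' (\<gamma> t) + f' (\<gamma> t) * g (\<gamma> t)) \<gamma> a b l"
    using c' by (intro primitive_along_mult[OF \<gamma>(2)] has_F_deriv_imp_primitive_along[OF eff f \<gamma>(1,2)]
        has_F_deriv_imp_primitive_along[OF eff g \<gamma>(1,2)] cont_funs_on_path[OF _ \<gamma>(3,4)])
  then show "primitive_along (\<lambda>t. (\<lambda>z\<in>X. f z * g z) (\<gamma> t)) (\<lambda>t. (\<lambda>z\<in>X. f z * g' z + f' z * g z) (\<gamma> t)) \<gamma> a b l"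
    by (rule primitive_along_restrict[OF \<gamma>(4)])
qed

text \<open>The product rule with a constant factor, whose derivative is 0.\<close>

lemma has_F_deriv_cmult:
  assumes eff: "effective X F" and f: "has_F_deriv X F f f'" and c: "f \<in> cont_funs X"
  shows "has_F_deriv X F (\<lambda>z\<in>X. c * f z) (\<lambda>z\<in>X. c * f' z)"
proof -
  have "has_F_deriv X F (\<lambda>z\<in>X. (\<lambda>z\<in>X. c) z * f z) (\<lambda>z\<in>X. (\<lambda>z\<in>X. c) z * f' z + (\<lambda>z\<in>X. 0) z * f z)"
    by (rule has_F_deriv_mult[OF eff has_F_deriv_const[OF eff] f _ c]) auto
  moreover have "(\<lambda>z\<in>X. (\<lambda>z\<in>X. c) z * f z) = (\<lambda>z\<in>X. c * f z)"
    "(\<lambda>z\<in>X. (\<lambda>z\<in>X. c) z * f' z + (\<lambda>z\<in>X. 0) z * f z) = (\<lambda>z\<in>X. c * f' z)" by auto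
  ultimately show ?thesis by simp
qed

lemma has_F_deriv_sum:
  assumes eff: "effective X F" and "finite I" and "\<And>i. i \<in> I \<Longrightarrow> has_F_deriv X F (f i) (f' i)"
  shows "has_F_deriv X F (\<lambda>z\<in>X. \<Sum>i\<in>I. f i z) (\<lambda>z\<in>X. \<Sum>i\<in>I. f' i z)"
  using assms(2,3)
proof (induction I rule: finite_induct)
  case empty
  then show ?case using has_F_deriv_const[OF eff, of 0] by (simp only: sum.empty)
next
  case (insert i I)
  have "has_F_deriv X F (\<lambda>z\<in>X. f i z + (\<lambda>z\<in>X. \<Sum>i\<in>I. f i z) z) (\<lambda>z\<in>X. f' i z + (\<lambda>z\<in>X. \<Sum>i\<in>I. f' i z) z)"
    by (intro has_F_deriv_add[OF eff] insert) auto
  moreover have "(\<lambda>z\<in>X. h i z + (\<lambda>z\<in>X. \<Sum>i\<in>I. h i z) z) = (\<lambda>z\<in>X. \<Sum>i\<in>insert i I. h i z)"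
    for h :: "_ \<Rightarrow> complex \<Rightarrow> complex"
    using insert.hyps by auto
  ultimately show ?case by (simp only:)
qed

definition leibniz :: "(nat \<Rightarrow> 'a::comm_semiring_1) \<Rightarrow> (nat \<Rightarrow> 'a) \<Rightarrow> nat \<Rightarrow> 'a" where
  "leibniz x y n = (\<Sum>k\<le>n. of_nat (n choose k) * (x k * y (n - k)))"

text \<open>Pascal's rule. The terms are grouped so that the \<open>k\<close>-th one is what the
  product rule gives for the \<open>k\<close>-th term of \<open>leibniz x y n\<close>.\<close>

lemma leibniz_Suc:
  "leibniz x y (Suc n) =
    (\<Sum>k\<le>n. of_nat (n choose k) * (x k * y (Suc n - k) + x (Suc k) * y (n - k)))"
proof -
  have "leibniz x y (Suc n) = x 0 * y (Suc n) +
      (\<Sum>k\<le>n. of_nat (Suc n choose Suc k) * (x (Suc k) * y (n - k)))"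
    unfolding leibniz_def sum.atMost_Suc_shift by simp
  also have "(\<Sum>k\<le>n. of_nat (Suc n choose Suc k) * (x (Suc k) * y (n - k))) =
      (\<Sum>k\<le>n. of_nat (n choose k) * (x (Suc k) * y (n - k)))
      + (\<Sum>k\<le>n. of_nat (n choose Suc k) * (x (Suc k) * y (n - k)))"
    by (simp add: sum.distrib[symmetric] distrib_right)
  also have "x 0 * y (Suc n) + (\<dots>) = (\<Sum>k\<le>n. of_nat (n choose k) * (x (Suc k) * y (n - k)))
     + (\<Sum>k\<le>Suc n. of_nat (n choose k) * (x k * y (Suc n - k)))"
    unfolding sum.atMost_Suc_shift by (simp add: add_ac)
  \<comment> \<open>The term \<open>k = Suc n\<close> vanishes because \<open>n choose Suc n\<close>
    is 0.\<close>
  also have "(\<Sum>k\<le>Suc n. of_nat (n choose k) * (x k * y (Suc n - k))) =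
      (\<Sum>k\<le>n. of_nat (n choose k) * (x k * y (Suc n - k)))"
    by (simp add: binomial_eq_0)
  also have "(\<Sum>k\<le>n. of_nat (n choose k) * (x (Suc k) * y (n - k))) + \<dots> =
      (\<Sum>k\<le>n. of_nat (n choose k) * (x k * y (Suc n - k) + x (Suc k) * y (n - k)))"
    by (simp add: sum.distrib distrib_left add.commute)
  finally show ?thesis .
qed

lemma has_F_deriv_leibniz:
  assumes eff: "effective X F" and f: "\<And>n. has_F_deriv X F (f n) (f (Suc n))"
    and g: "\<And>n. has_F_deriv X F (g n) (g (Suc n))"
    and c: "\<And>n. f n \<in> cont_funs X" "\<And>n. g n \<in> cont_funs X"
  shows "has_F_deriv X F (\<lambda>z\<in>X. leibniz (\<lambda>k. f k z) (\<lambda>k. g k z) n)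
    (\<lambda>z\<in>X. leibniz (\<lambda>k. f k z) (\<lambda>k. g k z) (Suc n))"
proof -
  \<comment> \<open>The nested restrictions have literally the form in which
    \<open>has_F_deriv_cmult\<close> and \<open>has_F_deriv_mult\<close> produce them.\<close>
  define P where "P k = (\<lambda>z\<in>X. of_nat (n choose k) * (\<lambda>z\<in>X. f k z * g (n - k) z) z)" for k
  define Q where "Q k = (\<lambda>z\<in>X. of_nat (n choose k) *
      (\<lambda>z\<in>X. f k z * g (Suc (n - k)) z + f (Suc k) z * g (n - k) z) z)" for k
  have "has_F_deriv X F (P k) (Q k)" for k
    unfolding P_def Q_def using c
    by (intro has_F_deriv_cmult[OF eff] has_F_deriv_mult[OF eff] f g restrict_cont_funs
        continuous_on_mult cont_funs_continuous)
  then have "has_F_deriv X F (\<lambda>z\<in>X. \<Sum>k\<le>n. P k z) (\<lambda>z\<in>X. \<Sum>k\<le>n. Q k z)"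
    by (intro has_F_deriv_sum[OF eff]) auto
  moreover have "(\<lambda>z\<in>X. \<Sum>k\<le>n. P k z) = (\<lambda>z\<in>X. leibniz (\<lambda>k. f k z) (\<lambda>k. g k z) n)"
    by (auto simp: leibniz_def P_def)
  moreover have "(\<lambda>z\<in>X. \<Sum>k\<le>n. Q k z) = (\<lambda>z\<in>X. leibniz (\<lambda>k. f k z) (\<lambda>k. g k z) (Suc n))"
    unfolding leibniz_Suc Q_def by (intro restrict_ext sum.cong) (auto simp: Suc_diff_le)
  ultimately show ?thesis by simp
qed

section \<open>Sup norms and closure under the algebra operations\<close>

lemma norm_le_sup_norm_on:
  assumes "compact X" "h \<in> cont_funs X" "z \<in> X"
  shows "norm (h z) \<le> sup_norm_on X h"
  unfolding sup_norm_on_def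
proof (rule cSUP_upper[OF assms(3)])
  have "compact ((\<lambda>x. norm (h x)) ` X)"
    using assms by (intro compact_continuous_image continuous_on_norm) (auto simp: cont_funs_def)
  then show "bdd_above ((\<lambda>x. norm (h x)) ` X)"
    by (rule bounded_imp_bdd_above[OF compact_imp_bounded])
qed

lemma sup_norm_on_le:
  assumes "X \<noteq> {}" "\<And>z. z \<in> X \<Longrightarrow> norm (h z) \<le> B"
  shows "sup_norm_on X h \<le> B"
  unfolding sup_norm_on_def using assms by (rule cSUP_least)

lemma sup_norm_on_nonneg:
  assumes "compact X" "X \<noteq> {}" "h \<in> cont_funs X"
  shows "0 \<le> sup_norm_on X h"
  using norm_le_sup_norm_on[OF assms(1,3)] assms(2) norm_ge_zero order_trans by (metis ex_in_conv)

text \<open>Reduces membership to a pointwise bound by a summable \<open>s\<close>; the suprema are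
  dealt with here once for all operations.\<close>

lemma D_F_alg_chainI:
  assumes eff: "effective X F" and X: "compact X" "X \<noteq> {}" and M: "\<And>n. M n > 0"
    and G: "G 0 \<in> cont_funs X" "\<And>n. has_F_deriv X F (G n) (G (Suc n))"
    and s: "summable s" and le: "\<And>n z. z \<in> X \<Longrightarrow> norm (G n z) / M n \<le> s n"
  shows "G 0 \<in> D_F_alg X F M"
proof -
  note chain = D_F_inf_chainI[of X F G, OF eff G]
  have "summable (\<lambda>n. sup_norm_on X (F_deriv_n X F n (G 0)) / M n)"
  proof (rule summable_comparison_test'[OF s])
    fix n
    have "G n \<in> cont_funs X" using F_deriv_n_cont_funs[OF eff chain(1), of n] by (simp add: chain(2))
    then have "0 \<le> sup_norm_on X (G n)" by (rule sup_norm_on_nonneg[OF X])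
    moreover have "sup_norm_on X (G n) \<le> s n * M n"
      using le M by (intro sup_norm_on_le[OF X(2)]) (simp add: pos_divide_le_eq)
    ultimately show "norm (sup_norm_on X (F_deriv_n X F n (G 0)) / M n) \<le> s n"
      using M[of n] by (simp add: chain(2) pos_divide_le_eq)
  qed
  with chain(1) show ?thesis by (simp add: D_F_alg_def)
qed

text \<open>For products, the algebra inequality bounds the weighted Leibniz sum by the Cauchy
  product of two summable sequences.\<close>

lemma subalgebra_D_F_alg:
  assumes eff: "effective X F" and X: "compact X" "X \<noteq> {}" and alg: "algebra_sequence M"
  shows "subalgebra_on X (D_F_alg X F M) (D_F_inf X F)"
proof -
  have M: "M n > 0" for n using alg by (simp add: algebra_sequence_def)
  define N where "N f n = sup_norm_on X (F_deriv_n X F n f) / M n" for f n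
  have D: "F_deriv_n X F n f \<in> cont_funs X" "has_F_deriv X F (F_deriv_n X F n f) (F_deriv_n X F (Suc n) f)"
     "F_deriv_n X F 0 f = f" "summable (N f)" "0 \<le> N f n"
     "z \<in> X \<Longrightarrow> norm (F_deriv_n X F n f z) / M n \<le> N f n"
     if f: "f \<in> D_F_alg X F M" for f n z
  proof -
    have "f \<in> D_F_inf X F" using f by (simp add: D_F_alg_def)
    then show *: "F_deriv_n X F n f \<in> cont_funs X" "has_F_deriv X F (F_deriv_n X F n f) (F_deriv_n X F (Suc n) f)"
      using F_deriv_n_cont_funs[OF eff] D_F_inf_iff[OF eff] by blast+
    show "F_deriv_n X F 0 f = f" by (simp add: F_deriv_n_def)
    show "summable (N f)" using f by (simp add: D_F_alg_def N_def[abs_def])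
    show "0 \<le> N f n" using sup_norm_on_nonneg[OF X *(1)] M[of n] by (simp add: N_def)
    show "norm (F_deriv_n X F n f z) / M n \<le> N f n" if "z \<in> X"
      using norm_le_sup_norm_on[OF X(1) *(1) that] M[of n] by (simp add: N_def divide_right_mono)
  qed
  show ?thesis
    unfolding subalgebra_on_def
  proof (intro conjI ballI allI)
    show "D_F_alg X F M \<subseteq> D_F_inf X F" by (auto simp: D_F_alg_def)
    show "(\<lambda>z\<in>X. 0) \<in> D_F_alg X F M"
      by (rule D_F_alg_chainI[OF eff X M, where G = "\<lambda>_. (\<lambda>z\<in>X. 0)" and s = "\<lambda>_. 0"])
        (auto intro: has_F_deriv_const[OF eff])
    fix f assume f: "f \<in> D_F_alg X F M"
    show "(\<lambda>z\<in>X. c * f z) \<in> D_F_alg X F M" for c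
    proof -
      have "(\<lambda>z\<in>X. c * F_deriv_n X F 0 f z) \<in> D_F_alg X F M"
      proof (rule D_F_alg_chainI[OF eff X M, where G = "\<lambda>n. (\<lambda>z\<in>X. c * F_deriv_n X F n f z)"
            and s = "\<lambda>n. norm c * N f n"])
        show "summable (\<lambda>n. norm c * N f n)" by (intro summable_mult D f)
        show "norm ((\<lambda>z\<in>X. c * F_deriv_n X F n f z) z) / M n \<le> norm c * N f n" if "z \<in> X" for n z
          using mult_left_mono[OF D(6)[OF f that, of n], of "norm c"] that by (simp add: norm_mult)
      qed (intro has_F_deriv_cmult[OF eff] D f restrict_cont_funs continuous_on_mult
          continuous_on_const cont_funs_continuous)+
      then show ?thesis by (simp add: F_deriv_n_def)
    qed
    fix g assume g: "g \<in> D_F_alg X F M"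
    show "(\<lambda>z\<in>X. f z + g z) \<in> D_F_alg X F M"
    proof -
      have "(\<lambda>z\<in>X. F_deriv_n X F 0 f z + F_deriv_n X F 0 g z) \<in> D_F_alg X F M"
      proof (rule D_F_alg_chainI[OF eff X M, where G = "\<lambda>n. (\<lambda>z\<in>X. F_deriv_n X F n f z + F_deriv_n X F n g z)"
            and s = "\<lambda>n. N f n + N g n"])
        show "summable (\<lambda>n. N f n + N g n)" by (intro summable_add D f g)
        show "norm ((\<lambda>z\<in>X. F_deriv_n X F n f z + F_deriv_n X F n g z) z) / M n \<le> N f n + N g n"
          if "z \<in> X" for n z
        proof -
          have "norm (F_deriv_n X F n f z + F_deriv_n X F n g z) / M n
            \<le> norm (F_deriv_n X F n f z) / M n + norm (F_deriv_n X F n g z) / M n"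
            unfolding add_divide_distrib[symmetric] using M[of n]
            by (intro divide_right_mono norm_triangle_ineq) simp
          with D(6)[OF f that, of n] D(6)[OF g that, of n] that show ?thesis by simp
        qed
      qed (intro has_F_deriv_add[OF eff] D f g restrict_cont_funs continuous_on_add cont_funs_continuous)+
      then show ?thesis by (simp add: F_deriv_n_def)
    qed
    show "(\<lambda>z\<in>X. f z * g z) \<in> D_F_alg X F M"
    proof -
      define G where "G n = (\<lambda>z\<in>X. leibniz (\<lambda>k. F_deriv_n X F k f z) (\<lambda>k. F_deriv_n X F k g z) n)" for n
      have "G 0 \<in> D_F_alg X F M"
      proof (rule D_F_alg_chainI[OF eff X M, where s = "\<lambda>n. \<Sum>k\<le>n. N f k * N g (n - k)"])
        show "G 0 \<in> cont_funs X"
          unfolding G_def leibniz_def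
          by (intro restrict_cont_funs continuous_on_sum continuous_on_mult continuous_on_const
              cont_funs_continuous D f g)
        show "has_F_deriv X F (G n) (G (Suc n))" for n
          unfolding G_def using f g by (intro has_F_deriv_leibniz[OF eff] D)
        show "summable (\<lambda>n. \<Sum>k\<le>n. N f k * N g (n - k))"
          using D(4,5)[OF f] D(4,5)[OF g] by (intro summable_Cauchy_product) simp_all
        fix n z assume z: "z \<in> X"
        have "norm (G n z) \<le> (\<Sum>k\<le>n. M n * (N f k * N g (n - k)))"
          unfolding G_def leibniz_def restrict_apply'[OF z]
        proof (rule sum_norm_le)
          fix k assume "k \<in> {..n}"
          then have k: "k + (n - k) = n" by simp
          have "real ((k + (n - k)) choose (n - k)) \<le> M (k + (n - k)) / (M k * M (n - k))"
            using alg unfolding algebra_sequence_def by blast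
          then have bin: "real (n choose k) \<le> M n / (M k * M (n - k))"
            unfolding k using \<open>k \<in> {..n}\<close> binomial_symmetric[of k n] by simp
          have "norm (of_nat (n choose k) * (F_deriv_n X F k f z * F_deriv_n X F (n - k) g z))
            = real (n choose k) * (norm (F_deriv_n X F k f z) * norm (F_deriv_n X F (n - k) g z))"
            by (simp add: norm_mult)
          also have "\<dots> \<le> M n / (M k * M (n - k)) * (norm (F_deriv_n X F k f z) * norm (F_deriv_n X F (n - k) g z))"
            using bin by (intro mult_right_mono) auto
          also have "\<dots> = M n * (norm (F_deriv_n X F k f z) / M k * (norm (F_deriv_n X F (n - k) g z) / M (n - k)))"
            by simp
          also have "\<dots> \<le> M n * (N f k * N g (n - k))"
            using M[of n] M[of "n - k"] f g z by (intro mult_left_mono mult_mono D) (auto simp: less_imp_le)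
          finally show "norm (of_nat (n choose k) * (F_deriv_n X F k f z * F_deriv_n X F (n - k) g z))
             \<le> M n * (N f k * N g (n - k))" .
        qed
        also have "\<dots> = (\<Sum>k\<le>n. N f k * N g (n - k)) * M n"
          by (simp add: sum_distrib_left mult.commute)
        finally show "norm (G n z) / M n \<le> (\<Sum>k\<le>n. N f k * N g (n - k))"
          using M[of n] by (simp add: pos_divide_le_eq)
      qed
      then show ?thesis by (simp add: G_def leibniz_def F_deriv_n_def)
    qed
  qed
qed

subsection \<open>A Denjoy--Carleman theorem\<close>

text \<open>\<open>\<phi> n\<close> stands for the \<open>n\<close>-th derivative along a path with arc length \<open>l\<close>.\<close>

locale derivative_chain =
  fixes \<phi> :: "nat \<Rightarrow> real \<Rightarrow> 'a::real_normed_vector" and l :: "real \<Rightarrow> real" and a b :: real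
  assumes ab: "a \<le> b"
    and l_cont: "continuous_on {a..b} l"
    and l_mono: "a \<le> x \<Longrightarrow> x \<le> y \<Longrightarrow> y \<le> b \<Longrightarrow> l x \<le> l y"
    and increment: "a \<le> x \<Longrightarrow> x \<le> y \<Longrightarrow> y \<le> b \<Longrightarrow> (\<And>s. s \<in> {x..y} \<Longrightarrow> norm (\<phi> (Suc n) s) \<le> B)
      \<Longrightarrow> norm (\<phi> n y - \<phi> n x) \<le> B * (l y - l x)"
begin

text \<open>Intermediate value theorem for \<open>l\<close>. The maximum covers the case that less
  than \<open>d\<close> of arc length remains.\<close>

lemma step_back:
  assumes "a \<le> x" "x \<le> y" "y \<le> b" "0 \<le> d"
  obtains s where "x \<le> s" "s \<le> y" "l s = max (l x) (l y - d)"
proof -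
  have "l x \<le> max (l x) (l y - d)" "max (l x) (l y - d) \<le> l y"
    using l_mono[OF assms(1-3)] \<open>0 \<le> d\<close> by auto
  moreover have "continuous_on {x..y} l"
    using l_cont by (rule continuous_on_subset) (use assms in auto)
  ultimately show ?thesis using IVT'[of l x "max (l x) (l y - d)" y] \<open>x \<le> y\<close> that by blast
qed

text \<open>The right side is the integral of the bound with respect to \<open>l\<close>. As
  \<open>increment\<close> takes constant bounds, the interval is cut into pieces of arc length at
  most \<open>d\<close>, at the loss of a factor \<open>exp (c * d)\<close>, which tends to
  1.\<close>

lemma increment_exp:
  assumes xy: "a \<le> x" "x \<le> y" "y \<le> b" and A: "0 \<le> A" and c: "0 < c"
    and bd: "\<And>s. s \<in> {x..y} \<Longrightarrow> norm (\<phi> (Suc n) s) \<le> A * exp (c * (l s - l x))"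
  shows "norm (\<phi> n y - \<phi> n x) \<le> A / c * (exp (c * (l y - l x)) - 1)"
proof -
  define E where "E s = A / c * exp (c * (l s - l x))" for s
  \<comment> \<open>\<open>N\<close> bounds the number of pieces. For \<open>N = 0\<close> the
    function \<open>l\<close> is constant on \<open>{x..t}\<close>, so \<open>\<phi> n\<close> does
    not move.\<close>
  have approx: "norm (\<phi> n t - \<phi> n x) \<le> exp (c * d) * (E t - E x)"
    if "0 < d" "t \<in> {x..y}" "l t - l x \<le> real N * d" for d t N
    using that(2,3)
  proof (induction N arbitrary: t)
    case 0
    then have lt: "l t = l x" using l_mono[of x t] xy by auto
    have "norm (\<phi> n t - \<phi> n x) \<le> A * (l t - l x)"
    proof (rule increment)
      fix s assume "s \<in> {x..t}"
      with 0 lt l_mono[of x s] l_mono[of s t] xy have "l s = l x" by auto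
      with bd[of s] \<open>s \<in> {x..t}\<close> 0 show "norm (\<phi> (Suc n) s) \<le> A" by auto
    qed (use 0 xy in auto)
    then show ?case by (simp add: lt E_def)
  next
    case (Suc N)
    obtain s where s: "x \<le> s" "s \<le> t" "l s = max (l x) (l t - d)"
      using step_back[of x t d] Suc.prems xy \<open>0 < d\<close> by auto
    define u where "u = l t - l s"
    have lts: "l s \<le> l t" using l_mono[of s t] s xy Suc.prems by auto
    have u: "0 \<le> u" "u \<le> d" using lts s(3) by (auto simp: u_def)
    have IH: "norm (\<phi> n s - \<phi> n x) \<le> exp (c * d) * (E s - E x)"
      by (rule Suc.IH) (use s Suc.prems \<open>0 < d\<close> in \<open>auto simp: algebra_simps max_def\<close>)
    have "norm (\<phi> n t - \<phi> n s) \<le> A * exp (c * (l t - l x)) * (l t - l s)"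
    proof (rule increment)
      fix v assume v: "v \<in> {s..t}"
      have "norm (\<phi> (Suc n) v) \<le> A * exp (c * (l v - l x))"
        using v s Suc.prems by (intro bd) auto
      also have "\<dots> \<le> A * exp (c * (l t - l x))"
        using v s Suc.prems xy A c l_mono[of v t] by (intro mult_left_mono) auto
      finally show "norm (\<phi> (Suc n) v) \<le> A * exp (c * (l t - l x))" .
    qed (use s xy Suc.prems in auto)
    also have "\<dots> = A * exp (c * (l s - l x)) * (exp (c * u) * u)"
      by (simp add: u_def exp_add[symmetric] algebra_simps)
    \<comment> \<open>Convexity of the exponential trades the length \<open>u\<close> for an
      increment of \<open>exp\<close>; replacing \<open>exp (c * u)\<close> by
      \<open>exp (c * d)\<close> is the loss.\<close>
    also have "\<dots> \<le> A * exp (c * (l s - l x)) * (exp (c * d) * ((exp (c * u) - 1) / c))"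
    proof -
      have "u * c \<le> exp (c * u) - 1"
        using exp_ge_add_one_self[of "c * u"] by (simp only: mult.commute[of u c] le_diff_eq add.commute)
      then have "u \<le> (exp (c * u) - 1) / c" using c by (simp add: pos_le_divide_eq)
      then show ?thesis using u c A by (intro mult_left_mono mult_mono) auto
    qed
    also have "\<dots> = exp (c * d) * (E t - E s)"
    proof -
      have "exp (c * (l t - l x)) = exp (c * (l s - l x)) * exp (c * u)"
        by (simp add: u_def exp_add[symmetric] algebra_simps)
      then show ?thesis using c by (simp add: E_def field_simps)
    qed
    finally have "norm (\<phi> n t - \<phi> n s) \<le> exp (c * d) * (E t - E s)" .
    with IH have "norm ((\<phi> n t - \<phi> n s) + (\<phi> n s - \<phi> n x))
        \<le> exp (c * d) * (E t - E s) + exp (c * d) * (E s - E x)"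
      by (intro norm_triangle_mono)
    then show ?case by (simp add: algebra_simps)
  qed
  have le: "norm (\<phi> n y - \<phi> n x) \<le> exp (c * d) * (E y - E x)" if d: "0 < d" for d
  proof -
    obtain N where "(l y - l x) / d < real N" using reals_Archimedean2 by blast
    then show ?thesis using approx[OF d, of y N] d xy by (simp add: pos_divide_less_eq)
  qed
  have "((\<lambda>d. exp (c * d) * (E y - E x)) \<longlongrightarrow> exp (c * 0) * (E y - E x)) (at_right 0)"
    by (intro tendsto_intros)
  moreover have "\<forall>\<^sub>F d in at_right 0. norm (\<phi> n y - \<phi> n x) \<le> exp (c * d) * (E y - E x)"
    using le by (auto simp: eventually_at_right_less eventually_at intro: exI[of _ 1])
  ultimately have "norm (\<phi> n y - \<phi> n x) \<le> exp (c * 0) * (E y - E x)"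
    by (intro tendsto_lowerbound) auto
  then show ?thesis by (simp add: E_def algebra_simps)
qed

text \<open>Descending induction from the order \<open>q\<close>, where the bound holds everywhere.
  The \<open>- 1\<close> in \<open>increment_exp\<close> cancels the initial value
  \<open>A * c ^ n\<close>, so one constant serves all orders.\<close>

lemma propagate:
  assumes st: "a \<le> s" "s \<le> t" "t \<le> b" and A: "0 \<le> A" and c: "0 < c" and "n \<le> q"
    and start: "\<And>n. n \<le> q \<Longrightarrow> norm (\<phi> n s) \<le> A * c ^ n"
    and top: "\<And>t. t \<in> {a..b} \<Longrightarrow> norm (\<phi> q t) \<le> A * c ^ q"
  shows "norm (\<phi> n t) \<le> A * c ^ n * exp (c * (l t - l s))"
  using \<open>n \<le> q\<close> st(2,3)
proof (induction n arbitrary: t rule: inc_induct)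
  case base
  have "norm (\<phi> q t) \<le> A * c ^ q * 1" using top base st by auto
  also have "\<dots> \<le> A * c ^ q * exp (c * (l t - l s))"
    using A c l_mono[of s t] base st by (intro mult_left_mono) auto
  finally show ?case .
next
  case (step n)
  have "norm (\<phi> n t - \<phi> n s) \<le> A * c ^ Suc n / c * (exp (c * (l t - l s)) - 1)"
    using A c st step by (intro increment_exp) auto
  also have "\<dots> = A * c ^ n * exp (c * (l t - l s)) - A * c ^ n"
    using c by (simp add: algebra_simps)
  finally have "norm (\<phi> n t - \<phi> n s) \<le> A * c ^ n * exp (c * (l t - l s)) - A * c ^ n" .
  with start[of n] step.hyps show ?case
    using norm_triangle_sub[of "\<phi> n t" "\<phi> n s"] by linarith
qed

text \<open>Descending from stage \<open>Suc k\<close> to stage \<open>k\<close> lets the point move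
  by arc length \<open>h k\<close>. By \<open>room\<close>, the drop of the constant from
  \<open>A k\<close> to \<open>A (Suc k)\<close> pays for this move and for the change of rate. As
  \<open>h\<close> is not summable, every point is reached from a high enough stage.\<close>

lemma vanish_if_vertices:
  fixes q :: "nat \<Rightarrow> nat" and r h :: "nat \<Rightarrow> real"
  assumes zero: "\<And>n. \<phi> n a = 0" and K: "0 \<le> K"
    and bd: "\<And>k t. t \<in> {a..b} \<Longrightarrow> norm (\<phi> (q k) t) \<le> K * r k ^ q k"
    and r: "\<And>k. 0 < r k" "\<And>k. r k \<le> r (Suc k)" and h: "\<And>k. 0 \<le> h k" "\<not> summable h"
    and room: "\<And>k. exp 1 * r (Suc k) * h k + real (q k) * (1 + ln (r (Suc k) / r k)) \<le> real (q (Suc k))"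
    and q: "filterlim (\<lambda>k. real (q k)) at_top sequentially"
    and t: "t \<in> {a..b}"
  shows "\<phi> 0 t = 0"
proof -
  have q_mono: "q k \<le> q (Suc k)" for k
  proof -
    have "0 \<le> exp 1 * r (Suc k) * h k" using r(1)[of "Suc k"] h(1)[of k] by simp
    moreover have "0 \<le> real (q k) * ln (r (Suc k) / r k)"
      using r(1)[of k] r(2)[of k] by (intro mult_nonneg_nonneg ln_ge_zero) auto
    ultimately have "real (q k) \<le> real (q (Suc k))" using room[of k] by (simp add: algebra_simps)
    then show ?thesis by simp
  qed
  \<comment> \<open>At the order \<open>q k\<close> the factors \<open>exp (- q k)\<close> and
    \<open>exp 1 ^ q k\<close> cancel, so the bound required at the top of stage \<open>k\<close> is
    exactly \<open>bd\<close>.\<close>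
  define A where "A k = K * exp (- real (q k))" for k
  define c where "c k = exp 1 * r k" for k
  have A: "0 \<le> A k" and c: "0 < c k" for k using K r by (auto simp: A_def c_def)
  have exp_q: "exp (- real m) * exp 1 ^ m = (1::real)" for m
    by (simp add: exp_of_nat_mult[symmetric] exp_minus_inverse mult.commute[of "exp (- real m)"])
  have Ac: "A k * c k ^ q k = K * r k ^ q k" for k
    using exp_q[of "q k"] by (simp add: A_def c_def power_mult_distrib mult.assoc[symmetric] mult.commute[of _ "exp 1 ^ _"])
  \<comment> \<open>The induction descends from stage \<open>J\<close>, where only points at arc
    length 0 from \<open>a\<close> occur and the zeros at \<open>a\<close> serve as initial
    values.\<close>
  have level: "norm (\<phi> n t) \<le> A k * c k ^ n"
    if "k \<le> J" "t \<in> {a..b}" "l t - l a \<le> (\<Sum>m=k..<J. h m)" "n \<le> q k" for k J t n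
    using that
  proof (induction k arbitrary: t n rule: inc_induct)
    case base
    then have "l t = l a" using l_mono[of a t] by auto
    moreover have "norm (\<phi> n t) \<le> A J * c J ^ n * exp (c J * (l t - l a))"
      using base A[of J] c[of J] ab zero bd[of _ J] Ac[of J] by (intro propagate) auto
    ultimately show ?case by simp
  next
    case (step k)
    obtain s where s: "a \<le> s" "s \<le> t" "l s = max (l a) (l t - h k)"
      using step_back[of a t "h k"] step.prems h by auto
    have "(\<Sum>m=k..<J. h m) = h k + (\<Sum>m=Suc k..<J. h m)"
      using step.hyps by (simp add: sum.atLeast_Suc_lessThan)
    moreover have "0 \<le> (\<Sum>m=Suc k..<J. h m)" by (intro sum_nonneg h)
    ultimately have ls: "l s - l a \<le> (\<Sum>m=Suc k..<J. h m)" using step.prems s(3) by auto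
    have "norm (\<phi> n t) \<le> A (Suc k) * c (Suc k) ^ n * exp (c (Suc k) * (l t - l s))"
    proof (rule propagate)
      show "norm (\<phi> n s) \<le> A (Suc k) * c (Suc k) ^ n" if "n \<le> q (Suc k)" for n
        using step.IH[of s n] that s step.prems ls by auto
      show "norm (\<phi> (q (Suc k)) t) \<le> A (Suc k) * c (Suc k) ^ q (Suc k)" if "t \<in> {a..b}" for t
        using bd[OF that] by (simp add: Ac)
      show "n \<le> q (Suc k)" using step.prems q_mono[of k] by auto
    qed (use s step.prems A c in auto)
    also have "\<dots> \<le> A k * c k ^ n"
    proof -
      \<comment> \<open>The change of rate costs \<open>\<rho> ^ n\<close>, which is at most
        \<open>\<rho> ^ q k\<close> because only orders up to \<open>q k\<close> are kept.\<close>
      define \<rho> where "\<rho> = r (Suc k) / r k"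
      have \<rho>: "1 \<le> \<rho>" using r by (simp add: \<rho>_def)
      have "c (Suc k) = c k * \<rho>" using r(1)[of k] by (simp add: c_def \<rho>_def)
      then have 1: "c (Suc k) ^ n = c k ^ n * \<rho> ^ n" by (simp add: power_mult_distrib)
      have "\<rho> ^ n \<le> \<rho> ^ q k" using \<rho> step.prems by (intro power_increasing) auto
      also have "\<dots> = exp (real (q k) * ln \<rho>)"
        using \<rho> by (simp add: exp_of_nat_mult)
      finally have 2: "\<rho> ^ n \<le> exp (real (q k) * ln \<rho>)" .
      have "c (Suc k) * (l t - l s) \<le> c (Suc k) * h k"
        using c[of "Suc k"] s(3) by (intro mult_left_mono) auto
      then have 3: "c (Suc k) * (l t - l s) \<le> exp 1 * r (Suc k) * h k" by (simp add: c_def)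
      have "A (Suc k) * c (Suc k) ^ n * exp (c (Suc k) * (l t - l s)) =
         K * c k ^ n * (exp (- real (q (Suc k))) * \<rho> ^ n * exp (c (Suc k) * (l t - l s)))"
        by (simp add: A_def 1)
      also have "\<dots> \<le> K * c k ^ n * (exp (- real (q (Suc k))) * exp (real (q k) * ln \<rho>)
          * exp (exp 1 * r (Suc k) * h k))"
        using K c[of k] 2 3 \<rho> by (intro mult_left_mono mult_mono) auto
      also have "\<dots> \<le> K * c k ^ n * exp (- real (q k))"
        unfolding exp_add[symmetric] using K c[of k] room[of k, folded \<rho>_def]
        by (intro mult_left_mono) (auto simp: algebra_simps)
      finally show ?thesis by (simp add: A_def mult_ac)
    qed
    finally show ?case .
  qed
  have "norm (\<phi> 0 t) \<le> K * exp (- real (q k))" for k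
  proof -
    \<comment> \<open>The tails of \<open>h\<close> diverge too, so a fixed stage \<open>k\<close>
      is reached from some stage \<open>k + N\<close>.\<close>
    have "\<not> summable (\<lambda>m. h (m + k))" using h(2) by (simp add: summable_iff_shift)
    then obtain N where N: "l t - l a < (\<Sum>m<N. h (m + k))"
      using summableI_nonneg_bounded[of "\<lambda>m. h (m + k)" "l t - l a"] h(1) by (meson not_le)
    have "(\<Sum>m<N. h (m + k)) = (\<Sum>m=k..<k + N. h m)"
      using sum.shift_bounds_nat_ivl[of h 0 k N] by (simp add: lessThan_atLeast0 add.commute)
    with level[of k "k + N" t 0] N t show ?thesis by (simp add: A_def)
  qed
  moreover have "(\<lambda>k. K * exp (- real (q k))) \<longlonglongrightarrow> K * 0"
    by (intro tendsto_intros filterlim_compose[OF exp_at_bot] filterlim_compose[OF filterlim_uminus_at_bot_at_top] q)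
  ultimately have "norm (\<phi> 0 t) \<le> K * 0" by (intro tendsto_lowerbound) auto
  then show ?thesis by simp
qed

end

section \<open>Choice of orders, rates and step lengths\<close>

text \<open>Of the growth \<open>3 ^ m\<close> the share 5/6 is to pay for the change of rate,
  leaving 1/6 for the step length. The base case is exactly \<open>ln 4 \<le> 3 / 2\<close>.\<close>

lemma ln_ratio_room: "1 \<le> m \<Longrightarrow> 1 + real m * ln 4 \<le> 5 / 6 * 3 ^ m"
proof (induction m rule: dec_induct)
  have "ln (4::real) = 2 * ln 2" using ln_realpow[of 2 2] by simp
  then have ln4: "ln (4::real) \<le> 3 / 2" using ln2_le_25_over_36 by simp
  case base
  show ?case using ln4 by simp
  case (step m)
  have "0 \<le> real m * ln 4" by simp
  moreover have "real (Suc m) * ln 4 = real m * ln 4 + ln 4" by (simp add: algebra_simps)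
  moreover have "(3::real) ^ Suc m = 3 * 3 ^ m" by simp
  ultimately show "1 + real (Suc m) * ln 4 \<le> 5 / 6 * 3 ^ Suc m" using step.IH ln4 by linarith
qed

text \<open>Two demands are met by the growth factor 3 in \<open>G\<close>: it is below 4, so that
  passing to \<open>G\<close> costs a geometric series of ratio 3/4, and it is large enough for
  \<open>ln_ratio_room\<close>. The maxima \<open>N j\<close> exist by \<open>fin\<close>.\<close>

lemma obtain_vertices:
  fixes M :: "nat \<Rightarrow> real"
  assumes M: "\<And>n. 0 < M n" "M 0 = 1" and fin: "\<And>R. finite {n. M n \<le> R ^ n}"
    and div: "filterlim (\<lambda>N. \<Sum>n=1..N. M n powr (- 1 / real n)) at_top sequentially"
  obtains q :: "nat \<Rightarrow> nat" and r h :: "nat \<Rightarrow> real" where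
    "\<And>k. M (q k) \<le> r k ^ q k" "\<And>k. 0 < r k" "\<And>k. r k \<le> r (Suc k)"
    "\<And>k. 0 \<le> h k" "\<not> summable h"
    "\<And>k. exp 1 * r (Suc k) * h k + real (q k) * (1 + ln (r (Suc k) / r k)) \<le> real (q (Suc k))"
    "filterlim (\<lambda>k. real (q k)) at_top sequentially"
proof -
  define N where "N j = Max {n. M n \<le> (4 ^ j) ^ n}" for j :: nat
  have N_in: "M (N j) \<le> (4 ^ j) ^ N j" for j
  proof -
    have "0 \<in> {n. M n \<le> (4 ^ j) ^ n}" using M by simp
    then have "N j \<in> {n. M n \<le> (4 ^ j) ^ n}" unfolding N_def using fin by (intro Max_in) blast+
    then show ?thesis by simp
  qed
  have N_ge: "n \<le> N j" if "M n \<le> (4 ^ j) ^ n" for n j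
    unfolding N_def using that fin by (intro Max_ge) auto
  define w where "w j = real (N j) / 4 ^ j" for j
  have w: "0 \<le> w j" for j by (simp add: w_def)
  have ex: "\<exists>j0. \<forall>j\<ge>j0. M n \<le> (4 ^ j) ^ n" if "1 \<le> n" for n
  proof -
    obtain j0 where j0: "M n < 4 ^ j0" using real_arch_pow[of 4 "M n"] by auto
    have "M n \<le> (4 ^ j) ^ n" if "j0 \<le> j" for j
    proof -
      have "M n \<le> 4 ^ j0" using j0 by simp
      also have "\<dots> \<le> 4 ^ (j * n)" using that \<open>1 \<le> n\<close>
        by (intro power_increasing) (auto intro: order_trans[of _ "j * 1"])
      finally show ?thesis by (simp add: power_mult)
    qed
    then show ?thesis by blast
  qed
  have "\<not> summable w"
  proof
    assume sw: "summable w"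
    \<comment> \<open>\<open>J n\<close> is the scale of \<open>n\<close>: when it is positive, the
      \<open>n\<close>-th root of \<open>M n\<close> lies between \<open>4 ^ (J n - 1)\<close> and
      \<open>4 ^ J n\<close>.\<close>
    define J where "J n = (LEAST j. M n \<le> (4 ^ j) ^ n)" for n
    have J: "M n \<le> (4 ^ J n) ^ n" if "1 \<le> n" for n
    proof -
      have "\<exists>j. M n \<le> (4 ^ j) ^ n" using ex[OF that] by blast
      then show ?thesis unfolding J_def by (rule LeastI_ex)
    qed
    have J_less: "(4 ^ j) ^ n < M n" if "j < J n" for j n
      using not_less_Least[of j "\<lambda>j. M n \<le> (4 ^ j) ^ n"] that by (simp add: J_def not_le)
    define T where "T n = M n powr (- 1 / real n)" for n
    \<comment> \<open>Terms with \<open>n \<le> N 0\<close>, among them all those of scale 0, are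
      kept as they are. For the others, minimality of \<open>J n\<close> gives the bound
      \<open>(1 / 4) ^ (J n - 1)\<close>.\<close>
    have T: "T n \<le> (if n \<le> N 0 then T n else 0) + 4 * (1 / 4) ^ J n" if n: "1 \<le> n" for n
    proof (cases "n \<le> N 0")
      case False
      then have "J n \<noteq> 0" using J[OF n] N_ge[of n 0] by (cases "J n") auto
      then obtain i where i: "J n = Suc i" using not0_implies_Suc by blast
      then have "4 ^ (i * n) \<le> M n" using J_less[of i n] by (simp add: power_mult)
      then have "T n \<le> (4 ^ (i * n)) powr (- 1 / real n)"
        unfolding T_def using n M by (intro powr_mono2') auto
      also have "\<dots> = 4 powr (real (i * n) * (- 1 / real n))"
        using powr_realpow[of 4 "i * n"] by (metis powr_powr zero_less_numeral)
      also have "real (i * n) * (- 1 / real n) = - real i" using n by simp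
      also have "4 powr (- real i) = (1 / 4) ^ i" by (simp add: powr_minus powr_realpow power_divide inverse_eq_divide)
      also have "\<dots> = 4 * (1 / 4) ^ J n" by (simp add: i)
      finally show ?thesis using False by simp
    qed auto
    have "(\<Sum>n=1..Q. T n) \<le> (\<Sum>n=1..N 0. T n) + 4 * suminf w" for Q
    proof -
      have "(\<Sum>n=1..Q. T n) \<le> (\<Sum>n=1..Q. (if n \<le> N 0 then T n else 0) + 4 * (1 / 4) ^ J n)"
        using T by (intro sum_mono) auto
      also have "\<dots> = (\<Sum>n=1..Q. if n \<le> N 0 then T n else 0) + 4 * (\<Sum>n=1..Q. (1 / 4) ^ J n)"
        by (simp add: sum.distrib sum_distrib_left)
      also have "(\<Sum>n=1..Q. if n \<le> N 0 then T n else 0) = (\<Sum>n | n \<in> {1..Q} \<and> n \<le> N 0. T n)"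
        by (rule sum.inter_filter[symmetric]) simp
      also have "\<dots> \<le> (\<Sum>n=1..N 0. T n)"
        by (intro sum_mono2) (auto simp: T_def)
      \<comment> \<open>Grouping by scale: since \<open>n \<le> N (J n)\<close>, at most
        \<open>N j\<close> indices have scale \<open>j\<close>, and they contribute at most
        \<open>w j\<close>.\<close>
      also have "(\<Sum>n=1..Q. (1 / 4 :: real) ^ J n) =
          (\<Sum>j\<in>J ` {1..Q}. \<Sum>n | n \<in> {1..Q} \<and> J n = j. (1 / 4) ^ J n)"
        by (rule sum.image_gen) simp
      also have "\<dots> \<le> (\<Sum>j\<in>J ` {1..Q}. w j)"
      proof (rule sum_mono)
        fix j
        have "{n. n \<in> {1..Q} \<and> J n = j} \<subseteq> {1..N j}" using J N_ge by fastforce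
        then have "card {n. n \<in> {1..Q} \<and> J n = j} \<le> N j" using card_mono[of "{1..N j}"] by simp
        then have "real (card {n. n \<in> {1..Q} \<and> J n = j}) * (1 / 4) ^ j \<le> real (N j) * (1 / 4) ^ j"
          by (intro mult_right_mono) auto
        then show "(\<Sum>n | n \<in> {1..Q} \<and> J n = j. (1 / 4) ^ J n) \<le> w j"
          by (simp add: w_def power_divide)
      qed
      also have "\<dots> \<le> suminf w" using sw w by (intro sum_le_suminf) auto
      finally show ?thesis by simp
    qed
    moreover from div have "\<exists>Q. (\<Sum>n=1..N 0. T n) + 4 * suminf w < (\<Sum>n=1..Q. T n)"
      unfolding T_def filterlim_at_top_dense eventually_sequentially by blast
    ultimately show False by (meson not_le)
  qed
  \<comment> \<open>The indices at which \<open>N j / 3 ^ j\<close> is a running maximum.\<close>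
  define G where "G = {j. \<forall>i<j. 3 ^ (j - i) * N i \<le> N j}"
  define wG where "wG j = (if j \<in> G then w j else 0)" for j
  have wG: "0 \<le> wG j" for j using w by (simp add: wG_def)
  have "\<not> summable wG"
  proof
    assume "summable wG"
    moreover have "summable (\<lambda>k. (3 / 4 :: real) ^ k)" by (rule summable_geometric) simp
    ultimately have "summable (\<lambda>j. \<Sum>i\<le>j. wG i * (3 / 4) ^ (j - i))"
      using wG by (intro summable_Cauchy_product) (simp_all add: power_abs)
    \<comment> \<open>An index \<open>i \<le> j\<close> maximizing \<open>N i / 3 ^ i\<close> lies
      in \<open>G\<close>, and \<open>w j \<le> w i * (3 / 4) ^ (j - i)\<close>. Thus a Cauchy
      product with a geometric series dominates \<open>w\<close>.\<close>
    moreover have "w j \<le> (\<Sum>i\<le>j. wG i * (3 / 4) ^ (j - i))" for j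
    proof -
      define S where "S i = real (N i) / 3 ^ i" for i
      have "Max (S ` {..j}) \<in> S ` {..j}" by (intro Max_in) auto
      then obtain i where i: "i \<le> j" "S i = Max (S ` {..j})"
        by (metis (no_types, lifting) atMost_iff imageE)
      then have S: "S k \<le> S i" if "k \<le> j" for k using that by simp
      have "3 ^ (i - k) * N k \<le> N i" if "k < i" for k
      proof -
        have "(3::real) ^ i = 3 ^ k * 3 ^ (i - k)" using that by (simp flip: power_add)
        with S[of k] that i have "3 ^ (i - k) * real (N k) \<le> real (N i)"
          by (simp add: S_def field_simps)
        then have "real (3 ^ (i - k) * N k) \<le> real (N i)" by simp
        then show ?thesis by (simp only: of_nat_le_iff)
      qed
      then have "i \<in> G" by (simp add: G_def)
      have "w j = S j * (3 / 4) ^ j" by (simp add: w_def S_def power_divide)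
      also have "\<dots> \<le> S i * (3 / 4) ^ j" using S[of j] by (intro mult_right_mono) auto
      also have "(3 / 4 :: real) ^ j = (3 / 4) ^ i * (3 / 4) ^ (j - i)" using i by (simp flip: power_add)
      also have "S i * ((3 / 4) ^ i * (3 / 4) ^ (j - i)) = wG i * (3 / 4) ^ (j - i)"
        using \<open>i \<in> G\<close> by (simp add: wG_def w_def S_def power_divide)
      also have "\<dots> \<le> (\<Sum>i\<le>j. wG i * (3 / 4) ^ (j - i))"
        using i wG by (intro member_le_sum) auto
      finally show ?thesis .
    qed
    ultimately have "summable w"
      using w by (intro summable_comparison_test'[of _ 0 w]) auto
    with \<open>\<not> summable w\<close> show False ..
  qed
  have "infinite G"
  proof
    assume "finite G"
    then have "summable wG" by (rule summable_finite) (simp add: wG_def)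
    with \<open>\<not> summable wG\<close> show False ..
  qed
  define v where "v = enumerate G"
  have v: "strict_mono v" "range v = G"
    unfolding v_def using \<open>infinite G\<close> by (simp_all add: strict_mono_enumerate range_enumerate)
  have not_summable_v: "\<not> summable (\<lambda>k. w (v k))"
  proof -
    have "summable (\<lambda>k. wG (v k)) \<longleftrightarrow> summable wG"
      using v by (intro summable_mono_reindex) (auto simp: wG_def)
    moreover have "wG (v k) = w (v k)" for k using v(2) by (auto simp: wG_def)
    ultimately show ?thesis using \<open>\<not> summable wG\<close> by simp
  qed
  show ?thesis
  \<comment> \<open>The step length makes \<open>exp 1 * r (Suc k) * h k\<close> one sixth of
    \<open>q (Suc k)\<close>; the other five sixths cover the term with \<open>q k\<close>.\<close>
  proof (rule that[of "\<lambda>k. N (v k)" "\<lambda>k. 4 ^ v k" "\<lambda>k. w (v (Suc k)) * (1 / (6 * exp 1))"])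
    fix k
    show "M (N (v k)) \<le> (4 ^ v k) ^ N (v k)" by (rule N_in)
    show "(4::real) ^ v k \<le> 4 ^ v (Suc k)"
      using strict_monoD[OF v(1), of k "Suc k"] by (intro power_increasing) auto
    show "0 \<le> w (v (Suc k)) * (1 / (6 * exp 1))" using w by simp
    define m where "m = v (Suc k) - v k"
    have vk: "v k < v (Suc k)" using strict_monoD[OF v(1), of k "Suc k"] by simp
    then have m: "1 \<le> m" "v (Suc k) = v k + m" by (auto simp: m_def)
    have "v (Suc k) \<in> G" using v(2) by auto
    then have "3 ^ m * N (v k) \<le> N (v (Suc k))" using vk by (simp add: G_def m_def)
    then have gr: "3 ^ m * real (N (v k)) \<le> real (N (v (Suc k)))"
      using of_nat_mono[where 'a = real] by fastforce
    have "ln (4 ^ v (Suc k) / 4 ^ v k :: real) = real m * ln 4"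
      by (simp add: m(2) power_add ln_realpow)
    then have "real (N (v k)) * (1 + ln (4 ^ v (Suc k) / 4 ^ v k)) \<le> real (N (v k)) * (5 / 6 * 3 ^ m)"
      using ln_ratio_room[OF m(1)] by (intro mult_left_mono) auto
    also have "\<dots> \<le> 5 / 6 * real (N (v (Suc k)))" using gr by (simp add: mult.commute)
    finally show "exp 1 * 4 ^ v (Suc k) * (w (v (Suc k)) * (1 / (6 * exp 1))) +
        real (N (v k)) * (1 + ln (4 ^ v (Suc k) / 4 ^ v k)) \<le> real (N (v (Suc k)))"
      by (simp add: w_def)
  next
    show "\<not> summable (\<lambda>k. w (v (Suc k)) * (1 / (6 * exp 1)))"
    proof
      assume "summable (\<lambda>k. w (v (Suc k)) * (1 / (6 * exp 1)))"
      from summable_mult2[OF this, of "6 * exp 1"] have "summable (\<lambda>k. w (v (Suc k)))" by simp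
      with not_summable_v show False using summable_Suc_iff[of "\<lambda>k. w (v k)"] by blast
    qed
    show "filterlim (\<lambda>k. real (N (v k))) at_top sequentially"
      unfolding filterlim_at_top eventually_sequentially
    proof (intro allI)
      fix Z :: real
      obtain n where n: "Z \<le> real n" "1 \<le> n" using real_arch_simple[of "max Z 1"] by auto
      obtain j0 where j0: "\<And>j. j0 \<le> j \<Longrightarrow> M n \<le> (4 ^ j) ^ n" using ex[OF n(2)] by blast
      have "Z \<le> real (N (v k))" if "j0 \<le> k" for k
      proof -
        have "j0 \<le> v k" using seq_suble[OF v(1), of k] that by simp
        then have "n \<le> N (v k)" by (intro N_ge j0)
        with n show ?thesis by linarith
      qed
      then show "\<exists>k0. \<forall>k\<ge>k0. Z \<le> real (N (v k))" by blast
    qed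
  qed auto
qed

section \<open>Vanishing on both sides of a common zero\<close>

lemma (in derivative_chain) quasianalytic_right:
  fixes M :: "nat \<Rightarrow> real"
  assumes "\<And>n. 0 < M n" "M 0 = 1" "\<And>R. finite {n. M n \<le> R ^ n}"
    and "filterlim (\<lambda>N. \<Sum>n=1..N. M n powr (- 1 / real n)) at_top sequentially"
    and bd: "\<And>n t. t \<in> {a..b} \<Longrightarrow> norm (\<phi> n t) \<le> K * M n"
    and zero: "\<And>n. \<phi> n a = 0" and t: "t \<in> {a..b}"
  shows "\<phi> 0 t = 0"
proof -
  have "0 \<le> norm (\<phi> 0 a)" by simp
  then have "0 \<le> K" using bd[of a 0] ab assms(2) by (simp add: zero)
  obtain q :: "nat \<Rightarrow> nat" and r h :: "nat \<Rightarrow> real" where V: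
    "\<And>k. M (q k) \<le> r k ^ q k" "\<And>k. 0 < r k" "\<And>k. r k \<le> r (Suc k)"
    "\<And>k. 0 \<le> h k" "\<not> summable h"
    "\<And>k. exp 1 * r (Suc k) * h k + real (q k) * (1 + ln (r (Suc k) / r k)) \<le> real (q (Suc k))"
    "filterlim (\<lambda>k. real (q k)) at_top sequentially"
    using obtain_vertices[OF assms(1-4)] by metis
  have "norm (\<phi> (q k) t) \<le> K * r k ^ q k" if "t \<in> {a..b}" for k t
    using bd[OF that, of "q k"] mult_left_mono[OF V(1)[of k] \<open>0 \<le> K\<close>] by linarith
  from vanish_if_vertices[OF zero \<open>0 \<le> K\<close> this V(2-7) t] show ?thesis .
qed

lemma (in derivative_chain) subinterval:
  assumes "a \<le> c" "c \<le> d" "d \<le> b"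
  shows "derivative_chain \<phi> l c d"
proof
  show "continuous_on {c..d} l"
    using l_cont by (rule continuous_on_subset) (use assms in auto)
qed (use assms in \<open>auto intro!: l_mono increment\<close>)

text \<open>Both signs in \<open>- l (- s)\<close> are needed to keep it increasing. The derivatives
  carry no factor \<open>(- 1) ^ n\<close>, since only norms of increments matter.\<close>

lemma (in derivative_chain) reflect: "derivative_chain (\<lambda>n s. \<phi> n (- s)) (\<lambda>s. - l (- s)) (- b) (- a)"
proof
  show "continuous_on {- b..- a} (\<lambda>s. - l (- s))"
    by (intro continuous_on_minus continuous_on_compose2[OF l_cont]) (auto intro: continuous_intros)
  show "- l (- x) \<le> - l (- y)" if "- b \<le> x" "x \<le> y" "y \<le> - a" for x y
    using l_mono[of "- y" "- x"] that by simp
  fix n x y B assume xy: "- b \<le> x" "x \<le> y" "y \<le> - a"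
    and B: "\<And>s. s \<in> {x..y} \<Longrightarrow> norm (\<phi> (Suc n) (- s)) \<le> B"
  have "norm (\<phi> n (- x) - \<phi> n (- y)) \<le> B * (l (- x) - l (- y))"
  proof (rule increment)
    show "norm (\<phi> (Suc n) s) \<le> B" if "s \<in> {- y..- x}" for s
      using B[of "- s"] that by simp
  qed (use xy in auto)
  then show "norm (\<phi> n (- y) - \<phi> n (- x)) \<le> B * (- l (- y) - - l (- x))"
    by (simp add: norm_minus_commute algebra_simps)
qed (use ab in simp)

theorem (in derivative_chain) quasianalytic:
  fixes M :: "nat \<Rightarrow> real"
  assumes M: "\<And>n. 0 < M n" "M 0 = 1" "\<And>R. finite {n. M n \<le> R ^ n}"
      "filterlim (\<lambda>N. \<Sum>n=1..N. M n powr (- 1 / real n)) at_top sequentially"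
    and bd: "\<And>n t. t \<in> {a..b} \<Longrightarrow> norm (\<phi> n t) \<le> K * M n"
    and s: "s \<in> {a..b}" and zero: "\<And>n. \<phi> n s = 0" and t: "t \<in> {a..b}"
  shows "\<phi> 0 t = 0"
proof (cases "s \<le> t")
  case True
  interpret right: derivative_chain \<phi> l s b
    using s by (intro subinterval) auto
  show ?thesis
    by (rule right.quasianalytic_right[OF M bd zero]) (use s t True in auto)
next
  case False
  interpret left: derivative_chain "\<lambda>n s. \<phi> n (- s)" "\<lambda>s. - l (- s)" "- s" "- a"
    using derivative_chain.reflect[OF subinterval[of a s]] s by auto
  have "\<phi> 0 (- (- t)) = 0"
    by (rule left.quasianalytic_right[OF M bd]) (use s t False zero in auto)
  then show ?thesis by simp
qed

section \<open>Algebra sequences and the conclusion along paths\<close>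

text \<open>Induction by the algebra inequality with \<open>k = 1\<close>, that is
  \<open>Suc n * (M n * M 1) \<le> M (Suc n)\<close>.\<close>

lemma algebra_sequence_ge_fact:
  assumes "algebra_sequence M"
  shows "fact n * M 1 ^ n \<le> M n"
proof (induction n)
  case 0
  then show ?case using assms by (simp add: algebra_sequence_def)
next
  case (Suc n)
  have M: "0 < M k" for k using assms by (simp add: algebra_sequence_def)
  have "real ((n + 1) choose 1) \<le> M (n + 1) / (M n * M 1)"
    using assms unfolding algebra_sequence_def by blast
  then have "real (Suc n) * (M n * M 1) \<le> M (Suc n)"
    using M[of n] M[of 1] by (simp add: pos_le_divide_eq)
  moreover have "real (Suc n) * (fact n * M 1 ^ n * M 1) \<le> real (Suc n) * (M n * M 1)"
    using Suc M[of 1] by (intro mult_left_mono mult_right_mono) auto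
  ultimately show ?case by (simp add: algebra_simps)
qed

text \<open>Factorial growth beats every geometric sequence. This supplies the finiteness behind the
  maxima in \<open>obtain_vertices\<close>.\<close>

lemma algebra_sequence_finite_le_power:
  assumes "algebra_sequence M"
  shows "finite {n. M n \<le> R ^ n}"
proof -
  have M1: "0 < M 1" using assms by (simp add: algebra_sequence_def)
  have "(\<lambda>n. inverse (fact n) * (R / M 1) ^ n) \<longlonglongrightarrow> 0"
    by (rule summable_LIMSEQ_zero[OF summable_exp])
  then have "\<forall>\<^sub>F n in sequentially. inverse (fact n) * (R / M 1) ^ n < 1"
    by (rule order_tendstoD) simp
  then obtain n0 where n0: "\<And>n. n0 \<le> n \<Longrightarrow> inverse (fact n) * (R / M 1) ^ n < 1"
    unfolding eventually_sequentially by blast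
  have "R ^ n < M n" if "n0 \<le> n" for n
  proof -
    have "R ^ n < fact n * M 1 ^ n"
      using n0[OF that] M1 by (simp add: power_divide field_simps)
    then show ?thesis using algebra_sequence_ge_fact[OF assms, of n] by linarith
  qed
  then have "{n. M n \<le> R ^ n} \<subseteq> {..<n0}" by (auto simp: not_le[symmetric])
  then show ?thesis by (rule finite_subset) simp
qed

text \<open>The increments are estimated by \<open>has_path_integral_bound\<close> with
  \<open>w = 0\<close>. The case \<open>x = y\<close> is separate because subpaths are
  non-degenerate.\<close>

lemma derivative_chain_F_deriv_n:
  assumes eff: "effective X F" and f: "f \<in> D_F_inf X F" and path: "(a, b, g) \<in> F"
    and l: "a \<le> b" "continuous_on {a..b} l" "variation_bound g a b l"
  shows "derivative_chain (\<lambda>n t. F_deriv_n X F n f (g t)) l a b"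
proof
  fix n x y B assume xy: "a \<le> x" "x \<le> y" "y \<le> b"
    and B: "\<And>s. s \<in> {x..y} \<Longrightarrow> norm (F_deriv_n X F (Suc n) f (g s)) \<le> B"
  show "norm (F_deriv_n X F n f (g y) - F_deriv_n X F n f (g x)) \<le> B * (l y - l x)"
  proof (cases "x = y")
    case False
    with xy have "x < y" by simp
    have "has_F_deriv X F (F_deriv_n X F n f) (F_deriv_n X F (Suc n) f)"
      using f D_F_inf_iff[OF eff] by blast
    from has_F_deriv_subpath[OF eff this path xy(1) \<open>x < y\<close> xy(3)]
    have "norm (F_deriv_n X F n f (g y) - F_deriv_n X F n f (g x)
        - 0 * (restrict g {x..y} y - restrict g {x..y} x)) \<le> B * (l y - l x)"
    proof (rule has_path_integral_bound[OF _ xy(2)])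
      show "variation_bound (restrict g {x..y}) x y l"
        using variation_bound_subinterval[OF l(3) xy(1,3)] by (simp add: variation_bound_def)
      show "norm (F_deriv_n X F (Suc n) f (restrict g {x..y} s) - 0) \<le> B" if "s \<in> {x..y}" for s
        using B[OF that] that by simp
    qed
    then show ?thesis by simp
  qed simp
qed (use l variation_bound_mono[OF l(3)] in auto)

theorem corollary3p9:
  fixes X :: "complex set" and F :: "plane_path set" and M :: "nat \<Rightarrow> real"
  assumes "compact X" and "X \<noteq> {}"
    and "semi_rectifiable X"
    and "effective X F"
    and "algebra_sequence M"
    and "filterlim (\<lambda>N. \<Sum>n=1..N. M n powr (- 1 / real n)) at_top sequentially"
  shows "F_quasianalytic X F (D_F_alg X F M)"
  unfolding F_quasianalytic_def
proof (intro conjI ballI impI)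
  show "subalgebra_on X (D_F_alg X F M) (D_F_inf X F)"
    by (rule subalgebra_D_F_alg[OF assms(4,1,2,5)])
  fix \<gamma> z0 f z
  assume "\<gamma> \<in> F" and z0: "z0 \<in> path_trace \<gamma>" and f: "f \<in> D_F_alg X F M"
    and zero: "\<forall>k. F_deriv_n X F k f z0 = 0" and z: "z \<in> path_trace \<gamma>"
  obtain a b g where \<gamma>: "\<gamma> = (a, b, g)" by (cases \<gamma>)
  with \<open>\<gamma> \<in> F\<close> have path: "(a, b, g) \<in> F" by simp
  obtain l where l: "a < b" "g ` {a..b} \<subseteq> X" "continuous_on {a..b} l" "variation_bound g a b l"
    using effective_path[OF assms(4) path] by metis
  have inf: "f \<in> D_F_inf X F" and sum: "summable (\<lambda>j. sup_norm_on X (F_deriv_n X F j f) / M j)"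
    using f by (simp_all add: D_F_alg_def)
  interpret derivative_chain "\<lambda>n t. F_deriv_n X F n f (g t)" l a b
    using l by (intro derivative_chain_F_deriv_n[OF assms(4) inf path]) auto
  \<comment> \<open>Each term of the series is at most its sum, so \<open>K * M n\<close> bounds the
    \<open>n\<close>-th derivative.\<close>
  define K where "K = (\<Sum>j. sup_norm_on X (F_deriv_n X F j f) / M j)"
  have M: "0 < M n" "M 0 = 1" for n using assms(5) by (simp_all add: algebra_sequence_def)
  note cont = F_deriv_n_cont_funs[OF assms(4) inf]
  have bd: "norm (F_deriv_n X F n f (g t)) \<le> K * M n" if "t \<in> {a..b}" for n t
  proof -
    have "norm (F_deriv_n X F n f (g t)) \<le> sup_norm_on X (F_deriv_n X F n f)"
      using l(2) that by (intro norm_le_sup_norm_on[OF assms(1) cont]) auto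
    moreover have "sup_norm_on X (F_deriv_n X F n f) / M n \<le> K"
      unfolding K_def
      using sum_le_suminf[OF sum, of "{n}"] sup_norm_on_nonneg[OF assms(1,2) cont] M(1)
      by (simp add: less_imp_le)
    ultimately show ?thesis using M(1)[of n] by (simp add: pos_divide_le_eq)
  qed
  obtain s t where st: "s \<in> {a..b}" "z0 = g s" "t \<in> {a..b}" "z = g t"
    using z0 z unfolding \<gamma> path_trace.simps by blast
  have "F_deriv_n X F 0 f (g t) = 0"
    by (rule quasianalytic[OF M algebra_sequence_finite_le_power[OF assms(5)] assms(6) bd st(1)])
      (use zero st in auto)
  then show "f z = 0" by (simp add: F_deriv_n_def st)
qed

end
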